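(* Let $q\in(-1,1)$ and let $X^{(q)}=\{X^{(q)}_t\}_{t\ge 0}$ be a $q$-Ornstein--Uhlenbeck process with càdlàg sample paths. For $\epsilon>0$ let $$A^{(q)}(\epsilon) := \left\{\exists\, t\in(0,1]:\ X^{(q)}_{t-}<-\frac{2}{\sqrt{1-q}}+\epsilon,\ X^{(q)}_t>\frac{2}{\sqrt{1-q}}-\epsilon\right\}.$$ Then $$\lim_{\epsilon\downarrow 0}\frac{\mathbb{P}(A^{(q)}(\epsilon))}{\epsilon^3}=\alpha_q,\qquad\text{where}\quad \alpha_q := \frac{1}{18\pi^2}(1-q)^{3/2}\prod_{k=1}^\infty\frac{(1-q^k)^7}{(1+q^k)^4}.$$
   Context: For $a\in\mathbb{R}$ and $q\in(-1,1)$ write $(a;q)_\infty := \prod_{k=0}^\infty(1-aq^k)$ and $(q)_\infty := (q;q)_\infty$ (with $0^0=1$). For $q\in(-1,1)$, the $q$-Ornstein--Uhlenbeck process $X^{(q)}=\{X^{(q)}_t\}_{t\ge 0}$ is the stationary Markov process with state space $\left[-\frac{2}{\sqrt{1-q}},\frac{2}{\sqrt{1-q}}\right]$ whose marginal (stationary) probability density function is $$p^{(q)}(x) = \frac{\sqrt{1-q}\,(q)_\infty}{2\pi}\sqrt{4-(1-q)x^2}\prod_{k=1}^\infty\left[(1+q^k)^2-(1-q)x^2q^k\right],$$ and whose transition probability density function is, for $0\le s<t$ and $x,y\in\left[-\frac{2}{\sqrt{1-q}},\frac{2}{\sqrt{1-q}}\right]$, $$p^{(q)}_{s,t}(x,y)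 = (e^{-2(t-s)};q)_\infty\prod_{k=0}^\infty\frac{1}{\varphi_{q,k}(t-s,x,y)}\cdot p^{(q)}(y),$$ where $$\varphi_{q,k}(\delta,x,y) = (1-e^{-2\delta}q^{2k})^2-(1-q)e^{-\delta}q^k(1+e^{-2\delta}q^{2k})xy+(1-q)e^{-2\delta}q^{2k}(x^2+y^2).$$ This process is known to have a version with sample paths in $D([0,\infty))$, the space of càdlàg functions on $[0,\infty)$, and $X^{(q)}$ is assumed to be in $D([0,\infty))$ with probability one. $X^{(q)}_{t-}$ denotes the left limit at $t$. *)

theory Defs
  imports "HOL-Probability.Probability"
begin

definition qpochhammer_inf :: "real \<Rightarrow> real \<Rightarrow> real" where
  "qpochhammer_inf a q = (\<Prod>k. 1 - a * q ^ k)"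

definition qOU_state_space :: "real \<Rightarrow> real set" where
  "qOU_state_space q = {- 2 / sqrt (1 - q) .. 2 / sqrt (1 - q)}"

text \<open>
  The densities below are extended by zero outside the state space: the closed formula alone
  would be negative there, as \<^term>\<open>sqrt x\<close> is negative for negative \<^term>\<open>x\<close>.
\<close>

definition qOU_density :: "real \<Rightarrow> real \<Rightarrow> real" where
  "qOU_density q x =
     indicator (qOU_state_space q) x *
     (sqrt (1 - q) * qpochhammer_inf q q / (2 * pi) * sqrt (4 - (1 - q) * x\<^sup>2) *
      (\<Prod>k. (1 + q ^ Suc k)\<^sup>2 - (1 - q) * x\<^sup>2 * q ^ Suc k))"

definition qOU_phi :: "real \<Rightarrow> nat \<Rightarrow> real \<Rightarrow> real \<Rightarrow> real \<Rightarrow> real" where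
  "qOU_phi q k \<delta> x y =
     (1 - exp (- 2 * \<delta>) * q ^ (2 * k))\<^sup>2
     - (1 - q) * exp (- \<delta>) * q ^ k * (1 + exp (- 2 * \<delta>) * q ^ (2 * k)) * x * y
     + (1 - q) * exp (- 2 * \<delta>) * q ^ (2 * k) * (x\<^sup>2 + y\<^sup>2)"

definition qOU_transition_density :: "real \<Rightarrow> real \<Rightarrow> real \<Rightarrow> real \<Rightarrow> real \<Rightarrow> real" where
  "qOU_transition_density q s t x y =
     qpochhammer_inf (exp (- 2 * (t - s))) q * (\<Prod>k. 1 / qOU_phi q k (t - s) x y) *
     qOU_density q y"

definition natural_past :: "'a measure \<Rightarrow> (real \<Rightarrow> 'a \<Rightarrow> real) \<Rightarrow> real \<Rightarrow> 'a measure" where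
  "natural_past M X s =
     sigma (space M) {X u -` B \<inter> space M | u B. 0 \<le> u \<and> u \<le> s \<and> B \<in> sets borel}"

text \<open>
  The last clause is at once the Markov property with respect to the natural filtration and the
  identification of the transition probabilities.
\<close>

definition qOU_process :: "real \<Rightarrow> 'a measure \<Rightarrow> (real \<Rightarrow> 'a \<Rightarrow> real) \<Rightarrow> bool" where
  "qOU_process q M X \<longleftrightarrow>
     (\<forall>t\<ge>0. X t \<in> M \<rightarrow>\<^sub>M restrict_space borel (qOU_state_space q)) \<and>
     (\<forall>t\<ge>0. distributed M lborel (X t) (\<lambda>x. ennreal (qOU_density q x))) \<and>
     (\<forall>s t. 0 \<le> s \<longrightarrow> s < t \<longrightarrow>
        (\<forall>B \<in> sets borel. AE \<omega> in M.
           real_cond_exp M (natural_past M X s) (indicator (X t -` B \<inter> space M)) \<omega>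
           = (LINT y:B|lborel. qOU_transition_density q s t (X s \<omega>) y)))"

definition cadlag :: "(real \<Rightarrow> real) \<Rightarrow> bool" where
  "cadlag f \<longleftrightarrow>
     (\<forall>t\<ge>0. (f \<longlongrightarrow> f t) (at_right t)) \<and> (\<forall>t>0. \<exists>l. (f \<longlongrightarrow> l) (at_left t))"

definition left_limit :: "(real \<Rightarrow> real) \<Rightarrow> real \<Rightarrow> real" where
  "left_limit f t = Lim (at_left t) f"

definition qOU_jump_event ::
  "real \<Rightarrow> 'a measure \<Rightarrow> (real \<Rightarrow> 'a \<Rightarrow> real) \<Rightarrow> real \<Rightarrow> 'a set" where
  "qOU_jump_event q M X \<epsilon> =
     {\<omega> \<in> space M. \<exists>t\<in>{0<..1}.
        left_limit (\<lambda>s. X s \<omega>) t < - 2 / sqrt (1 - q) + \<epsilon> \<and> X t \<omega> > 2 / sqrt (1 - q) - \<epsilon>}"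

definition qOU_alpha :: "real \<Rightarrow> real" where
  "qOU_alpha q =
     1 / (18 * pi\<^sup>2) * (1 - q) powr (3 / 2) * (\<Prod>k. (1 - q ^ Suc k) ^ 7 / (1 + q ^ Suc k) ^ 4)"

text \<open>
  Paths are only required to be cadlag almost surely, and on the exceptional null set the jump
  event need not be measurable with respect to a non-complete measure. Its probability is
  therefore to be taken with respect to the completion, which agrees with the original measure on
  all its measurable sets.
\<close>

definition qOU_jump_prob ::
  "real \<Rightarrow> 'a measure \<Rightarrow> (real \<Rightarrow> 'a \<Rightarrow> real) \<Rightarrow> real \<Rightarrow> real" where
  "qOU_jump_prob q M X \<epsilon> = measure (completion M) (qOU_jump_event q M X \<epsilon>)"

end

theory Submission
  imports Defs "HOL-Real_Asymp.Real_Asymp"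
begin

text \<open>
  Write \<open>R = 2 / sqrt (1 - q)\<close>, let \<open>L\<close> and \<open>U\<close> be the parts of the state space within \<open>\<epsilon>\<close> of
  \<open>- R\<close> and \<open>R\<close>, and let \<open>m\<close> be their common stationary mass. As the density vanishes like a
  square root at the edges, \<open>m\<close> is asymptotic to a constant times \<open>\<epsilon> powr (3 / 2)\<close>. Near the two
  opposite edges and for small times \<open>\<delta>\<close> the transition density is \<open>\<kappa> * \<delta>\<close> times the stationary
  one, up to a factor close to \<open>1\<close>. Hence on the mesh \<open>1 / n\<close> the expected number of one-step
  passages from \<open>L\<close> to \<open>U\<close> is about \<open>\<kappa> * m\<^sup>2\<close>, and by the Markov property two such passages have
  probability \<open>O(m ^ 3)\<close>, which is negligible. For cadlag paths the jump event is, up to an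
  arbitrarily small change of \<open>\<epsilon>\<close>, both the limes inferior and the limes superior of these
  discrete events.
\<close>

subsection \<open>Infinite products and the stationary density\<close>

text \<open>At time 0 the factor of \<open>qOU_phi\<close> with \<open>k = 0\<close> is
  \<open>(1 - q) * (x - y) ^ 2\<close>, so the product in the denominator of the transition density
  vanishes on the diagonal. At opposite edges that factor is 16, and all the others are positive.
  The kernel is therefore studied only as a limit at the single corner (time 0, \<open>x\<close> at
  the lower edge, \<open>y\<close> at the upper edge), jointly in the three variables. The term
  linear in time is \<open>1 - exp (- 2 * \<delta>)\<close>, the first factor of the Pochhammer
  symbol. For the second passage, the requirement to start again near the lower edge is simply
  dropped. An earlier passage has probability of order \<open>m ^ 2\<close>, each later step adds a
  factor of order \<open>m / n\<close>, and summing over the \<open>n\<close> steps gives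
  \<open>m ^ 3\<close>, with no estimate of how the process forgets its past. A jump is passed on to
  all fine grids with the same \<open>\<epsilon>\<close>, but a limit of grid passages satisfies
  only weak inequalities. This is why the lower bound is taken at a smaller width
  \<open>\<theta> * \<epsilon>\<close>, with \<open>\<theta>\<close> sent to 1 at the end.\<close>

lemma convergent_prod_geometric:
  fixes f :: "nat \<Rightarrow> real"
  assumes "0 \<le> r" "r < 1" and "\<And>k. \<bar>f k - 1\<bar> \<le> C * r ^ k"
  shows "convergent_prod f"
proof -
  have "summable (\<lambda>k. C * r ^ k)"
    using assms by (intro summable_mult summable_geometric) auto
  then have "summable (\<lambda>k. norm (f k - 1))"
    by (rule summable_comparison_test'[where N = 0]) (use assms in auto)
  then show ?thesis
    by (intro abs_convergent_prod_imp_convergent_prod summable_imp_abs_convergent_prod)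
qed

text \<open>The M-test for the sums of \<open>norm (f k x - 1)\<close> makes the partial products
  converge uniformly, so continuity survives the limit. It serves the weight of the density, the
  product of \<open>qOU_phi\<close>, and the Pochhammer symbol as a function of time.\<close>

lemma continuous_on_prodinf_geometric:
  fixes f :: "nat \<Rightarrow> 'a::topological_space \<Rightarrow> real"
  assumes "compact K" and cont: "\<And>k. continuous_on K (f k)"
    and r: "0 \<le> r" "r < 1" and bound: "\<And>k x. x \<in> K \<Longrightarrow> \<bar>f k x - 1\<bar> \<le> C * r ^ k"
  shows "continuous_on K (\<lambda>x. \<Prod>k. f k x)"
proof -
  have "summable (\<lambda>k. C * r ^ k)"
    using r by (intro summable_mult summable_geometric) auto
  then have "uniformly_convergent_on K (\<lambda>N x. \<Sum>k<N. norm (f k x - 1))"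
    by (rule Weierstrass_m_test'[rotated]) (use bound in auto)
  then have "uniformly_convergent_on K (\<lambda>N x. \<Prod>k<N. f k x)"
    by (intro uniformly_convergent_on_prod' assms)
  then have lim: "uniform_limit K (\<lambda>N x. \<Prod>k<N. f k x) (\<lambda>x. lim (\<lambda>N. \<Prod>k<N. f k x)) sequentially"
    by (simp add: uniformly_convergent_uniform_limit_iff)
  have "continuous_on K (\<lambda>x. lim (\<lambda>N. \<Prod>k<N. f k x))"
    by (rule uniform_limit_theorem[OF _ lim]) (auto intro!: always_eventually continuous_intros cont)
  moreover have "lim (\<lambda>N. \<Prod>k<N. f k x) = (\<Prod>k. f k x)" if "x \<in> K" for x
  proof -
    have "convergent_prod (\<lambda>k. f k x)"
      using r bound[OF that] by (rule convergent_prod_geometric)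
    then have "(\<lambda>N. \<Prod>k<N. f k x) \<longlonglongrightarrow> (\<Prod>k. f k x)"
      unfolding LIMSEQ_lessThan_iff_atMost by (rule convergent_prod_LIMSEQ)
    then show ?thesis
      by (rule limI)
  qed
  ultimately show ?thesis
    by (simp cong: continuous_on_cong)
qed

lemma convergent_prod_one_minus_power:
  fixes q a :: real
  assumes "\<bar>q\<bar> < 1"
  shows "convergent_prod (\<lambda>k. 1 - a * q ^ k)" "convergent_prod (\<lambda>k. 1 - q ^ Suc k)"
    "convergent_prod (\<lambda>k. 1 + q ^ k)" "convergent_prod (\<lambda>k. 1 + q ^ Suc k)"
proof -
  have *: "convergent_prod (\<lambda>k. 1 - a * q ^ k)" for a
    by (rule convergent_prod_geometric[of "\<bar>q\<bar>" _ "\<bar>a\<bar>"]) (use assms in \<open>auto simp: abs_mult power_abs\<close>)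
  show "convergent_prod (\<lambda>k. 1 - a * q ^ k)" by (rule *)
  show "convergent_prod (\<lambda>k. 1 - q ^ Suc k)" using *[of q] by simp
  show "convergent_prod (\<lambda>k. 1 + q ^ k)" using *[of "-1"] by simp
  show "convergent_prod (\<lambda>k. 1 + q ^ Suc k)" using *[of "-q"] by simp
qed

lemma power_less_1_abs:
  fixes q :: real
  assumes "\<bar>q\<bar> < 1"
  shows "\<bar>q ^ Suc k\<bar> < 1"
  using power_Suc_less_one[of "\<bar>q\<bar>" k] assms
  by (cases "q = 0") (auto simp: power_abs simp flip: power_Suc)

lemma qpochhammer_self: "qpochhammer_inf q q = (\<Prod>k. 1 - q ^ Suc k)"
  by (simp add: qpochhammer_inf_def)

lemma qpochhammer_self_pos:
  assumes "\<bar>q\<bar> < 1"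
  shows "0 < qpochhammer_inf q q"
  unfolding qpochhammer_self
proof (rule less_0_prodinf)
  show "convergent_prod (\<lambda>k. 1 - q ^ Suc k)"
    by (rule convergent_prod_one_minus_power[OF assms])
  show "0 < 1 - q ^ Suc k" for k
    using power_less_1_abs[OF assms, of k] by linarith
qed

lemma prodinf_one_plus_power_pos:
  fixes q :: real
  assumes "\<bar>q\<bar> < 1"
  shows "0 < (\<Prod>k. 1 + q ^ Suc k)"
proof (rule less_0_prodinf)
  show "convergent_prod (\<lambda>k. 1 + q ^ Suc k)"
    by (rule convergent_prod_one_minus_power[OF assms])
  show "0 < 1 + q ^ Suc k" for k
    using power_less_1_abs[OF assms, of k] by linarith
qed

definition qOU_radius :: "real \<Rightarrow> real" where
  "qOU_radius q = 2 / sqrt (1 - q)"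

lemma qOU_radius_pos: "q < 1 \<Longrightarrow> 0 < qOU_radius q"
  by (simp add: qOU_radius_def)

lemma qOU_radius_square: "q < 1 \<Longrightarrow> (1 - q) * (qOU_radius q)\<^sup>2 = 4"
  by (simp add: qOU_radius_def power_divide del: left_diff_distrib_numeral)

lemma qOU_state_space_eq: "qOU_state_space q = {- qOU_radius q .. qOU_radius q}"
  by (simp add: qOU_state_space_def qOU_radius_def)

lemma state_space_product_le:
  assumes "q < 1" "x \<in> qOU_state_space q" "y \<in> qOU_state_space q"
  shows "(1 - q) * \<bar>x * y\<bar> \<le> 4" "(1 - q) * x\<^sup>2 \<le> 4"
proof -
  have *: "(1 - q) * \<bar>x * y\<bar> \<le> 4" if "x \<in> qOU_state_space q" "y \<in> qOU_state_space q" for x y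
  proof -
    have "\<bar>x\<bar> * \<bar>y\<bar> \<le> qOU_radius q * qOU_radius q"
      using that qOU_radius_pos[OF assms(1)] by (intro mult_mono) (auto simp: qOU_state_space_eq)
    then have "(1 - q) * \<bar>x * y\<bar> \<le> (1 - q) * (qOU_radius q)\<^sup>2"
      using assms(1) by (intro mult_left_mono) (auto simp: abs_mult power2_eq_square)
    then show ?thesis
      using qOU_radius_square[OF assms(1)] by simp
  qed
  show "(1 - q) * \<bar>x * y\<bar> \<le> 4" using * assms by blast
  show "(1 - q) * x\<^sup>2 \<le> 4" using *[of x x] assms by (simp add: power2_eq_square abs_mult_self_eq)
qed

definition qOU_weight :: "real \<Rightarrow> real \<Rightarrow> real" where
  "qOU_weight q x = (\<Prod>k. (1 + q ^ Suc k)\<^sup>2 - (1 - q) * x\<^sup>2 * q ^ Suc k)"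

text \<open>The density without its factor \<open>sqrt (qOU_radius q - x)\<close>. It is continuous
  up to the upper edge, and its value there is the coefficient of the square-root zero.\<close>

definition qOU_edge :: "real \<Rightarrow> real \<Rightarrow> real" where
  "qOU_edge q x = (1 - q) * qpochhammer_inf q q / (2 * pi) * sqrt (qOU_radius q + x) * qOU_weight q x"

lemma qOU_weight_bound:
  assumes "\<bar>q\<bar> < 1" "x \<in> qOU_state_space q"
  shows "\<bar>((1 + q ^ Suc k)\<^sup>2 - (1 - q) * x\<^sup>2 * q ^ Suc k) - 1\<bar> \<le> 7 * \<bar>q\<bar> ^ k"
proof -
  let ?a = "q ^ Suc k"
  have 1: "0 \<le> (1 - q) * x\<^sup>2" "(1 - q) * x\<^sup>2 \<le> 4"
    using state_space_product_le(2)[of q x] assms by auto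
  have a: "\<bar>?a\<bar> < 1" using power_less_1_abs[OF assms(1)] .
  have "((1 + ?a)\<^sup>2 - (1 - q) * x\<^sup>2 * ?a) - 1 = ?a * (2 + ?a - (1 - q) * x\<^sup>2)"
    by (simp add: power2_eq_square algebra_simps)
  then have "\<bar>((1 + ?a)\<^sup>2 - (1 - q) * x\<^sup>2 * ?a) - 1\<bar> = \<bar>?a\<bar> * \<bar>2 + ?a - (1 - q) * x\<^sup>2\<bar>"
    by (metis abs_mult)
  \<comment> \<open>The second factor is below 3 in absolute value; 7 is a crude bound, as only
    summability is at stake.\<close>
  also have "\<dots> \<le> \<bar>?a\<bar> * 7"
    using a 1 by (intro mult_left_mono) linarith+
  also have "\<bar>?a\<bar> \<le> \<bar>q\<bar> ^ k"
    using assms(1) by (auto simp: abs_mult power_abs intro!: mult_left_le_one_le)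
  finally show ?thesis by simp
qed

lemma continuous_on_qOU_weight:
  assumes "\<bar>q\<bar> < 1"
  shows "continuous_on (qOU_state_space q) (qOU_weight q)"
  unfolding qOU_weight_def
proof (rule continuous_on_prodinf_geometric[where r = "\<bar>q\<bar>" and C = 7])
  show "compact (qOU_state_space q)" by (simp add: qOU_state_space_def)
qed (use assms qOU_weight_bound in \<open>auto intro!: continuous_intros simp del: power_Suc\<close>)

text \<open>The worst case for a factor depends on the sign of \<open>?a\<close>: the edge
  \<open>?b = 4\<close>, leaving \<open>(1 - ?a) ^ 2\<close>, or the centre \<open>?b = 0\<close>,
  leaving \<open>(1 + ?a) ^ 2\<close>. Both are positive, and \<open>convergent_prod\<close>
  excludes a product that tends to 0.\<close>

lemma qOU_weight_pos:
  assumes "\<bar>q\<bar> < 1" "x \<in> qOU_state_space q"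
  shows "0 < qOU_weight q x"
  unfolding qOU_weight_def
proof (rule less_0_prodinf)
  show "convergent_prod (\<lambda>k. (1 + q ^ Suc k)\<^sup>2 - (1 - q) * x\<^sup>2 * q ^ Suc k)"
    by (rule convergent_prod_geometric[of "\<bar>q\<bar>" _ 7]) (use assms qOU_weight_bound in auto)
  fix k
  let ?a = "q ^ Suc k" and ?b = "(1 - q) * x\<^sup>2"
  have b: "0 \<le> ?b" "?b \<le> 4"
    using state_space_product_le(2)[of q x] assms by auto
  have a: "\<bar>?a\<bar> < 1" using power_less_1_abs[OF assms(1)] .
  show "0 < (1 + ?a)\<^sup>2 - ?b * ?a"
  proof (cases "0 \<le> ?a")
    case True
    have "?b * ?a \<le> 4 * ?a" using b True by (intro mult_right_mono)
    moreover have "(1 + ?a)\<^sup>2 - 4 * ?a = (1 - ?a)\<^sup>2" by (simp add: power2_eq_square algebra_simps)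
    moreover have "0 < (1 - ?a)\<^sup>2" using a by auto
    ultimately show ?thesis by linarith
  next
    case False
    have "?b * ?a \<le> 0" using b False by (intro mult_nonneg_nonpos) auto
    moreover have "0 < (1 + ?a)\<^sup>2" using a by auto
    ultimately show ?thesis by linarith
  qed
qed

lemma qOU_weight_radius:
  assumes "\<bar>q\<bar> < 1"
  shows "qOU_weight q (qOU_radius q) = (qpochhammer_inf q q)\<^sup>2"
proof -
  have "(1 + q ^ Suc k)\<^sup>2 - (1 - q) * (qOU_radius q)\<^sup>2 * q ^ Suc k = (1 - q ^ Suc k)\<^sup>2" for k
  proof -
    have "(1 - q) * (qOU_radius q)\<^sup>2 = 4" using qOU_radius_square[of q] assms by auto
    then show ?thesis by (simp only:) (simp add: power2_eq_square algebra_simps)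
  qed
  then have "qOU_weight q (qOU_radius q) = (\<Prod>k. (1 - q ^ Suc k)\<^sup>2)"
    unfolding qOU_weight_def by presburger
  also have "\<dots> = (\<Prod>k. 1 - q ^ Suc k)\<^sup>2"
    by (rule prodinf_power) (rule convergent_prod_one_minus_power[OF assms])
  finally show ?thesis by (simp add: qpochhammer_self)
qed

text \<open>Factoring \<open>4 - (1 - q) * x ^ 2\<close> over its two roots, the edges, isolates the
  zero at the upper one.\<close>

lemma qOU_density_eq:
  assumes "q < 1"
  shows "qOU_density q x = indicator (qOU_state_space q) x * (sqrt (qOU_radius q - x) * qOU_edge q x)"
proof (cases "x \<in> qOU_state_space q")
  case True
  have "4 - (1 - q) * x\<^sup>2 = (1 - q) * ((qOU_radius q - x) * (qOU_radius q + x))"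
    using qOU_radius_square[OF assms] by (simp add: power2_eq_square algebra_simps)
  then have "sqrt (1 - q) * sqrt (4 - (1 - q) * x\<^sup>2)
      = (sqrt (1 - q) * sqrt (1 - q)) * (sqrt (qOU_radius q - x) * sqrt (qOU_radius q + x))"
    by (simp add: real_sqrt_mult)
  also have "sqrt (1 - q) * sqrt (1 - q) = 1 - q" using assms by simp
  finally have "sqrt (1 - q) * sqrt (4 - (1 - q) * x\<^sup>2)
      = (1 - q) * (sqrt (qOU_radius q - x) * sqrt (qOU_radius q + x))" .
  then have "(sqrt (1 - q) * sqrt (4 - (1 - q) * x\<^sup>2)) * (qpochhammer_inf q q / (2 * pi) * qOU_weight q x)
      = ((1 - q) * (sqrt (qOU_radius q - x) * sqrt (qOU_radius q + x))) * (qpochhammer_inf q q / (2 * pi) * qOU_weight q x)"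
    by simp
  then show ?thesis
    by (auto simp: qOU_density_def qOU_weight_def qOU_edge_def ac_simps)
qed (simp add: qOU_density_def)

lemma qOU_edge_nonneg:
  assumes "\<bar>q\<bar> < 1" "x \<in> qOU_state_space q"
  shows "0 \<le> qOU_edge q x"
  using qOU_weight_pos[OF assms] qpochhammer_self_pos[OF assms(1)] assms
  by (auto simp: qOU_edge_def qOU_state_space_eq)

lemma qOU_density_nonneg:
  assumes "\<bar>q\<bar> < 1"
  shows "0 \<le> qOU_density q x"
  using qOU_edge_nonneg[OF assms, of x] assms
  by (auto simp: qOU_density_eq qOU_state_space_eq split: split_indicator)

lemma qOU_density_minus: "qOU_density q (- x) = qOU_density q x"
  by (auto simp: qOU_density_def qOU_state_space_eq split: split_indicator)

lemma continuous_on_qOU_edge: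
  assumes "\<bar>q\<bar> < 1"
  shows "continuous_on (qOU_state_space q) (qOU_edge q)"
  unfolding qOU_edge_def by (intro continuous_intros continuous_on_qOU_weight assms)

text \<open>The power 3/2 comes from \<open>(1 - q) ^ 2\<close> times twice the radius
  \<open>2 / sqrt (1 - q)\<close>. The sixth power is the square of three copies of
  \<open>qpochhammer_inf q q\<close>: one from the normalisation, two from the weight at the
  edge.\<close>

lemma qOU_edge_radius_square:
  assumes "\<bar>q\<bar> < 1"
  shows "(qOU_edge q (qOU_radius q))\<^sup>2 = (1 - q) powr (3 / 2) * qpochhammer_inf q q ^ 6 / pi\<^sup>2"
proof -
  have q: "0 < 1 - q" using assms by auto
  have "(1 - q) powr (3 / 2) = (1 - q) * sqrt (1 - q)"
    using powr_add[of "1 - q" 1 "1/2"] q by (simp add: powr_half_sqrt)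
  moreover have "(1 - q)\<^sup>2 * (qOU_radius q + qOU_radius q) = 4 * ((1 - q) * sqrt (1 - q))"
  proof -
    define r where "r = sqrt (1 - q)"
    have "r > 0" "1 - q = r * r" using q by (auto simp: r_def)
    moreover have "qOU_radius q = 2 / r" by (simp add: qOU_radius_def r_def)
    ultimately show ?thesis unfolding r_def[symmetric] by (simp add: power2_eq_square)
  qed
  ultimately have *: "(1 - q)\<^sup>2 * (qOU_radius q + qOU_radius q) = 4 * (1 - q) powr (3 / 2)"
    by simp
  have "(qOU_edge q (qOU_radius q))\<^sup>2
     = ((1 - q) * qpochhammer_inf q q / (2 * pi) * (qpochhammer_inf q q)\<^sup>2)\<^sup>2
       * (sqrt (qOU_radius q + qOU_radius q))\<^sup>2"
    unfolding qOU_edge_def qOU_weight_radius[OF assms] power_mult_distrib[symmetric]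
    by (simp add: mult_ac)
  also have "(sqrt (qOU_radius q + qOU_radius q))\<^sup>2 = qOU_radius q + qOU_radius q"
    using qOU_radius_pos[of q] q by simp
  also have "((1 - q) * qpochhammer_inf q q / (2 * pi) * (qpochhammer_inf q q)\<^sup>2)\<^sup>2
      * (qOU_radius q + qOU_radius q)
     = ((1 - q)\<^sup>2 * (qOU_radius q + qOU_radius q)) * qpochhammer_inf q q ^ 6 / (4 * pi\<^sup>2)"
    by (simp add: eval_nat_numeral mult_ac)
  also have "\<dots> = (1 - q) powr (3 / 2) * qpochhammer_inf q q ^ 6 / pi\<^sup>2"
    unfolding * by simp
  finally show ?thesis .
qed


section \<open>Transition density for small times between opposite edges\<close>

definition qOU_phi_prod :: "real \<Rightarrow> real \<Rightarrow> real \<Rightarrow> real \<Rightarrow> real" where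
  "qOU_phi_prod q \<delta> x y = (\<Prod>k. qOU_phi q k \<delta> x y)"

text \<open>The limit at the corner of the transition density divided by the elapsed time and by
  \<open>qOU_density q y\<close>. The numerator is the slope at 0 of
  \<open>qpochhammer_inf (exp (- 2 * \<delta>)) q\<close>.\<close>

definition qOU_jump_rate :: "real \<Rightarrow> real" where
  "qOU_jump_rate q = 2 * qpochhammer_inf q q / qOU_phi_prod q 0 (- qOU_radius q) (qOU_radius q)"

lemma qOU_phi_bound:
  assumes "\<bar>q\<bar> < 1" "0 \<le> \<delta>" "x \<in> qOU_state_space q" "y \<in> qOU_state_space q"
  shows "\<bar>qOU_phi q k \<delta> x y - 1\<bar> \<le> 19 * \<bar>q\<bar> ^ k"
proof -
  define a u v where "a = q ^ k" and "u = exp (- \<delta>)" and "v = exp (- 2 * \<delta>)"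
  define w z where "w = (1 - q) * (x * y)" and "z = (1 - q) * x\<^sup>2 + (1 - q) * y\<^sup>2"
  have w: "\<bar>w\<bar> \<le> 4" and z: "\<bar>z\<bar> \<le> 8"
    using state_space_product_le[of q x y] state_space_product_le[of q y x] assms
    by (auto simp: w_def z_def abs_mult abs_if[of q] split: if_splits)
  have u: "\<bar>u\<bar> \<le> 1" and v: "\<bar>v\<bar> \<le> 1"
    using assms by (auto simp: u_def v_def)
  have a: "\<bar>a\<bar> \<le> 1"
    using assms by (auto simp: a_def power_abs intro!: power_le_one)
  have le1: "\<bar>b * c\<bar> \<le> 1" if "\<bar>b\<bar> \<le> 1" "\<bar>c\<bar> \<le> 1" for b c :: real
    using that by (simp add: abs_mult mult_le_one)
  have va: "\<bar>v * a\<bar> \<le> 1" "\<bar>v * a * (v * a) * a\<bar> \<le> 1" "\<bar>v * a * a\<bar> \<le> 1"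
    by (intro le1 a v)+
  have 1: "\<bar>w * (u * (1 + v * a * a))\<bar> \<le> 4 * 2"
  proof -
    have "\<bar>u * (1 + v * a * a)\<bar> \<le> 1 * 2"
      unfolding abs_mult[of u] using u va by (intro mult_mono) auto
    then show ?thesis
      unfolding abs_mult[of w] using w by (intro mult_mono) auto
  qed
  have 2: "\<bar>z * (v * a)\<bar> \<le> 8 * 1"
    unfolding abs_mult[of z] using z va by (intro mult_mono) auto
  have a2: "q ^ (2 * k) = a * a"
    by (simp add: a_def mult_2 power_add)
  \<comment> \<open>Every term of the difference contains \<open>a = q ^ k\<close>, which gives the
    geometric decay. The four terms in the bracket are at most 2, 1, 8 and 8, whence 19.\<close>
  have "qOU_phi q k \<delta> x y - 1
      = a * (- 2 * (v * a) + v * a * (v * a) * a - w * (u * (1 + v * a * a)) + z * (v * a))"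
    unfolding qOU_phi_def a2 a_def[symmetric] u_def[symmetric] v_def[symmetric] w_def z_def
    by (simp add: power2_eq_square algebra_simps)
  also have "\<bar>\<dots>\<bar> \<le> \<bar>a\<bar> * 19"
    unfolding abs_mult[of a] using va 1 2 by (intro mult_left_mono) auto
  finally show ?thesis
    by (simp add: a_def power_abs)
qed

text \<open>The set includes the diagonal at time 0, where the product is 0; hence the product is
  treated here, and its reciprocal only near the corner.\<close>

lemma continuous_on_qOU_phi_prod:
  assumes "\<bar>q\<bar> < 1"
  shows "continuous_on ({0..1} \<times> qOU_state_space q \<times> qOU_state_space q)
           (\<lambda>(\<delta>, x, y). qOU_phi_prod q \<delta> x y)"
  unfolding qOU_phi_prod_def case_prod_beta
proof (rule continuous_on_prodinf_geometric[where r = "\<bar>q\<bar>" and C = 19])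
  show "compact ({0..1::real} \<times> qOU_state_space q \<times> qOU_state_space q)"
    by (intro compact_Times) (auto simp: qOU_state_space_def)
  show "continuous_on ({0..1} \<times> qOU_state_space q \<times> qOU_state_space q)
      (\<lambda>p. qOU_phi q k (fst p) (fst (snd p)) (snd (snd p)))" for k
    unfolding qOU_phi_def by (intro continuous_intros)
  show "\<bar>qOU_phi q k (fst p) (fst (snd p)) (snd (snd p)) - 1\<bar> \<le> 19 * \<bar>q\<bar> ^ k"
    if "p \<in> {0..1} \<times> qOU_state_space q \<times> qOU_state_space q" for p k
    using that assms by (intro qOU_phi_bound) auto
qed (use assms in auto)

text \<open>At opposite edges and time 0, \<open>(1 - q) * (qOU_radius q) ^ 2 = 4\<close> turns
  every factor into \<open>(1 + q ^ k) ^ 4\<close>; the 16 is the factor for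
  \<open>k = 0\<close>.\<close>

lemma qOU_phi_prod_edges:
  assumes "\<bar>q\<bar> < 1"
  shows "qOU_phi_prod q 0 (- qOU_radius q) (qOU_radius q) = 16 * (\<Prod>k. 1 + q ^ Suc k) ^ 4"
proof -
  have "qOU_phi q k 0 (- qOU_radius q) (qOU_radius q) = (1 + q ^ k) ^ 4" for k
  proof -
    have R: "(1 - q) * (qOU_radius q)\<^sup>2 = 4" using qOU_radius_square[of q] assms by auto
    have 2: "q ^ (2 * k) = q ^ k * q ^ k" by (simp add: mult_2 power_add)
    have "qOU_phi q k 0 (- qOU_radius q) (qOU_radius q) =
       (1 - q ^ k * q ^ k)\<^sup>2 + ((1 - q) * (qOU_radius q)\<^sup>2) * q ^ k * (1 + q ^ k * q ^ k)
       + 2 * ((1 - q) * (qOU_radius q)\<^sup>2) * (q ^ k * q ^ k)"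
      unfolding qOU_phi_def 2 by (simp, algebra)
    also have "\<dots> = (1 + q ^ k) ^ 4"
      unfolding R by algebra
    finally show ?thesis .
  qed
  then have "qOU_phi_prod q 0 (- qOU_radius q) (qOU_radius q) = (\<Prod>k. (1 + q ^ k) ^ 4)"
    by (simp add: qOU_phi_prod_def)
  also have "\<dots> = (\<Prod>k. 1 + q ^ k) ^ 4"
    by (rule prodinf_power) (rule convergent_prod_one_minus_power[OF assms])
  also have "(\<Prod>k. 1 + q ^ k) = 2 * (\<Prod>k. 1 + q ^ Suc k)"
    using prodinf_split_head[OF convergent_prod_one_minus_power(3)[OF assms]] by simp
  finally show ?thesis
    by (simp add: power_mult_distrib)
qed

lemma qOU_jump_rate_pos:
  assumes "\<bar>q\<bar> < 1"
  shows "0 < qOU_jump_rate q"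
  using qpochhammer_self_pos[OF assms] prodinf_one_plus_power_pos[OF assms]
  by (simp add: qOU_jump_rate_def qOU_phi_prod_edges[OF assms])

text \<open>The constant \<open>1 / 18\<close> is \<open>2 / 16\<close> from the rate times
  \<open>4 / 9\<close> from the squared edge coefficient. The power 7 is 1 from the rate plus 6 from
  \<open>qOU_edge_radius_square\<close>.\<close>

lemma qOU_alpha_eq:
  assumes "\<bar>q\<bar> < 1"
  shows "qOU_alpha q = qOU_jump_rate q * (2 / 3 * qOU_edge q (qOU_radius q))\<^sup>2"
proof -
  have "(\<Prod>k. (1 - q ^ Suc k) ^ 7 / (1 + q ^ Suc k) ^ 4)
      = (\<Prod>k. (1 - q ^ Suc k) ^ 7) / (\<Prod>k. (1 + q ^ Suc k) ^ 4)"
    by (intro prodinf_divide[symmetric] convergent_prod_power convergent_prod_one_minus_power assms)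
  also have "(\<Prod>k. (1 - q ^ Suc k) ^ 7) = qpochhammer_inf q q ^ 7"
    unfolding qpochhammer_self by (intro prodinf_power convergent_prod_one_minus_power assms)
  also have "(\<Prod>k. (1 + q ^ Suc k) ^ 4) = (\<Prod>k. 1 + q ^ Suc k) ^ 4"
    by (intro prodinf_power convergent_prod_one_minus_power assms)
  finally have *: "(\<Prod>k. (1 - q ^ Suc k) ^ 7 / (1 + q ^ Suc k) ^ 4)
      = qpochhammer_inf q q ^ 7 / (\<Prod>k. 1 + q ^ Suc k) ^ 4" .
  show ?thesis
    unfolding qOU_alpha_def * qOU_jump_rate_def qOU_phi_prod_edges[OF assms]
      power_mult_distrib qOU_edge_radius_square[OF assms]
    by (simp add: power2_eq_square eval_nat_numeral mult_ac)
qed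

text \<open>Splitting off the factor for \<open>k = 0\<close> of the Pochhammer symbol exposes the
  term that is linear for small times. For \<open>y\<close> outside the state space both sides
  vanish with the density.\<close>

lemma qOU_transition_density_eq:
  assumes "\<bar>q\<bar> < 1" "s < t" "x \<in> qOU_state_space q"
  shows "qOU_transition_density q s t x y =
    (1 - exp (- 2 * (t - s))) * (\<Prod>k. 1 - exp (- 2 * (t - s)) * q ^ Suc k)
      / qOU_phi_prod q (t - s) x y * qOU_density q y"
proof (cases "y \<in> qOU_state_space q")
  case True
  have "(\<Prod>k. 1 / qOU_phi q k (t - s) x y) = 1 / qOU_phi_prod q (t - s) x y"
    unfolding qOU_phi_prod_def inverse_eq_divide[symmetric]
  proof (rule prodinf_inverse)
    show "convergent_prod (\<lambda>k. qOU_phi q k (t - s) x y)"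
      by (rule convergent_prod_geometric[of "\<bar>q\<bar>" _ 19])
        (use assms True in \<open>auto intro!: qOU_phi_bound\<close>)
  qed
  moreover have "qpochhammer_inf (exp (- 2 * (t - s))) q
      = (1 - exp (- 2 * (t - s))) * (\<Prod>k. 1 - exp (- 2 * (t - s)) * q ^ Suc k)"
    unfolding qpochhammer_inf_def
    using prodinf_split_head[OF convergent_prod_one_minus_power(1)[OF assms(1), of "exp (- 2 * (t - s))"]]
      \<open>s < t\<close> by simp
  ultimately show ?thesis
    by (simp add: qOU_transition_density_def)
qed (simp add: qOU_transition_density_def qOU_density_def)

text \<open>\<open>p0\<close> lies outside \<open>K\<close>, where time is positive, so dividing by
  \<delta> is harmless. The second claim later yields measurability in \<open>y\<close> of the
  transition density near the upper edge.\<close>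

lemma qOU_jump_kernel_tendsto:
  assumes "\<bar>q\<bar> < 1"
  defines "K \<equiv> {0<..1} \<times> qOU_state_space q \<times> qOU_state_space q"
  defines "p0 \<equiv> (0, - qOU_radius q, qOU_radius q)"
  shows "((\<lambda>(\<delta>, x, y). (1 - exp (- 2 * \<delta>)) / \<delta> * (\<Prod>k. 1 - exp (- 2 * \<delta>) * q ^ Suc k)
            / qOU_phi_prod q \<delta> x y) \<longlongrightarrow> qOU_jump_rate q) (at p0 within K)"
    and "\<forall>\<^sub>F (\<delta>, x, y) in at p0 within K. qOU_phi_prod q \<delta> x y \<noteq> 0"
proof -
  have R: "0 < qOU_radius q" using qOU_radius_pos[of q] assms(1) by auto
  let ?K' = "{0..1} \<times> qOU_state_space q \<times> qOU_state_space q"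
  have p0: "p0 \<in> ?K'" and K: "K \<subseteq> ?K'"
    using R by (auto simp: p0_def K_def qOU_state_space_eq)
  have "((\<lambda>(\<delta>, x, y). qOU_phi_prod q \<delta> x y) \<longlongrightarrow> (case p0 of (\<delta>, x, y) \<Rightarrow> qOU_phi_prod q \<delta> x y)) (at p0 within ?K')"
    using continuous_on_qOU_phi_prod[OF assms(1)] p0 by (auto simp: continuous_on_def)
  then have phi: "((\<lambda>(\<delta>, x, y). qOU_phi_prod q \<delta> x y) \<longlongrightarrow> qOU_phi_prod q 0 (- qOU_radius q) (qOU_radius q)) (at p0 within K)"
    using tendsto_within_subset[OF _ K] by (simp add: p0_def)
  have phi0: "qOU_phi_prod q 0 (- qOU_radius q) (qOU_radius q) \<noteq> 0"
    using prodinf_one_plus_power_pos[OF assms(1)] by (simp add: qOU_phi_prod_edges[OF assms(1)])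
  show "\<forall>\<^sub>F (\<delta>, x, y) in at p0 within K. qOU_phi_prod q \<delta> x y \<noteq> 0"
    using tendsto_imp_eventually_ne[OF phi phi0] by (simp add: case_prod_unfold)
  \<comment> \<open>Along \<open>K\<close> the time tends to 0 from the right, so one-variable
    limits in \<delta> compose with \<open>fst\<close>.\<close>
  have fst0: "filterlim fst (at_right 0) (at p0 within K)"
    unfolding filterlim_at
  proof
    show "\<forall>\<^sub>F p in at p0 within K. fst p \<in> {0<..} \<and> fst p \<noteq> (0::real)"
      by (auto simp: eventually_at_filter K_def intro!: always_eventually)
    show "(fst \<longlongrightarrow> (0::real)) (at p0 within K)"
      using tendsto_fst[OF tendsto_ident_at, of p0 K] by (simp add: p0_def)
  qed
  have "continuous_on {0..1} (\<lambda>\<delta>. \<Prod>k. 1 - exp (- 2 * \<delta>) * q ^ Suc k)"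
  proof (rule continuous_on_prodinf_geometric[where r = "\<bar>q\<bar>" and C = 1])
    fix k and \<delta> :: real assume \<delta>: "\<delta> \<in> {0..1}"
    have "exp (- 2 * \<delta>) * (\<bar>q\<bar> * \<bar>q\<bar> ^ k) \<le> 1 * (1 * \<bar>q\<bar> ^ k)"
      using \<delta> assms(1) by (intro mult_mono) auto
    then show "\<bar>(1 - exp (- 2 * \<delta>) * q ^ Suc k) - 1\<bar> \<le> 1 * \<bar>q\<bar> ^ k"
      by (simp add: abs_mult power_abs)
  qed (use assms(1) in \<open>auto intro!: continuous_intros\<close>)
  then have "((\<lambda>\<delta>. \<Prod>k. 1 - exp (- 2 * \<delta>) * q ^ Suc k) \<longlongrightarrow> qpochhammer_inf q q) (at 0 within {0..1})"
    by (auto simp: continuous_on_def qpochhammer_self dest!: bspec[where x = 0])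
  then have "((\<lambda>\<delta>. \<Prod>k. 1 - exp (- 2 * \<delta>) * q ^ Suc k) \<longlongrightarrow> qpochhammer_inf q q) (at_right 0)"
    by (simp add: at_within_Icc_at_right)
  moreover have "((\<lambda>\<delta>::real. (1 - exp (- 2 * \<delta>)) / \<delta>) \<longlongrightarrow> 2) (at_right 0)"
    by real_asymp
  ultimately have "((\<lambda>\<delta>. (1 - exp (- 2 * \<delta>)) / \<delta> * (\<Prod>k. 1 - exp (- 2 * \<delta>) * q ^ Suc k))
      \<longlongrightarrow> 2 * qpochhammer_inf q q) (at_right 0)"
    by (rule tendsto_mult[rotated])
  then have "((\<lambda>p. (1 - exp (- 2 * fst p)) / fst p * (\<Prod>k. 1 - exp (- 2 * fst p) * q ^ Suc k))
      \<longlongrightarrow> 2 * qpochhammer_inf q q) (at p0 within K)"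
    by (rule filterlim_compose[OF _ fst0])
  from tendsto_divide[OF this phi phi0]
  show "((\<lambda>(\<delta>, x, y). (1 - exp (- 2 * \<delta>)) / \<delta> * (\<Prod>k. 1 - exp (- 2 * \<delta>) * q ^ Suc k)
            / qOU_phi_prod q \<delta> x y) \<longlongrightarrow> qOU_jump_rate q) (at p0 within K)"
    by (simp add: case_prod_unfold qOU_jump_rate_def)
qed

lemma qOU_transition_density_bounds:
  assumes "\<bar>q\<bar> < 1" "0 < \<eta>"
  obtains d where "0 < d" "d < 1"
    "\<And>s t x y. \<lbrakk>s < t; t < s + d; x \<in> qOU_state_space q; x < - qOU_radius q + d;
        y \<in> qOU_state_space q; qOU_radius q - d < y\<rbrakk> \<Longrightarrow>
      qOU_phi_prod q (t - s) x y \<noteq> 0 \<and>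
      (qOU_jump_rate q - \<eta>) * (t - s) * qOU_density q y \<le> qOU_transition_density q s t x y \<and>
      qOU_transition_density q s t x y \<le> (qOU_jump_rate q + \<eta>) * (t - s) * qOU_density q y"
proof -
  define K where "K = {0<..1::real} \<times> qOU_state_space q \<times> qOU_state_space q"
  define p0 where "p0 = (0::real, - qOU_radius q, qOU_radius q)"
  define J where "J = (\<lambda>\<delta> x y. (1 - exp (- 2 * \<delta>)) / \<delta> * (\<Prod>k. 1 - exp (- 2 * \<delta>) * q ^ Suc k)
            / qOU_phi_prod q \<delta> x y)"
  have "\<forall>\<^sub>F p in at p0 within K. dist (case p of (\<delta>, x, y) \<Rightarrow> J \<delta> x y) (qOU_jump_rate q) < \<eta>"
    using qOU_jump_kernel_tendsto(1)[OF assms(1)] \<open>0 < \<eta>\<close>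
    unfolding K_def p0_def J_def by (rule tendstoD)
  moreover note qOU_jump_kernel_tendsto(2)[OF assms(1), folded K_def p0_def]
  ultimately have "\<forall>\<^sub>F (\<delta>, x, y) in at p0 within K.
      qOU_phi_prod q \<delta> x y \<noteq> 0 \<and> \<bar>J \<delta> x y - qOU_jump_rate q\<bar> < \<eta>"
    by eventually_elim (auto simp: dist_real_def)
  then obtain e where e: "0 < e" and J: "\<And>\<delta> x y. \<lbrakk>(\<delta>, x, y) \<in> K; dist (\<delta>, x, y) p0 < e; (\<delta>, x, y) \<noteq> p0\<rbrakk> \<Longrightarrow>
      qOU_phi_prod q \<delta> x y \<noteq> 0 \<and> \<bar>J \<delta> x y - qOU_jump_rate q\<bar> < \<eta>"
    unfolding eventually_at by fastforce
  \<comment> \<open>The distance to the corner is at most the sum of three coordinate distances,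
    each below \<open>e / 3\<close>; the bound \<open>1/2\<close> keeps the time inside
    \<open>K\<close>.\<close>
  define d where "d = min (1/2) (e / 3)"
  show thesis
  proof (rule that[of d])
    show "0 < d" "d < 1" using e by (auto simp: d_def)
    fix s t x y
    assume st: "s < t" "t < s + d" and x: "x \<in> qOU_state_space q" "x < - qOU_radius q + d"
      and y: "y \<in> qOU_state_space q" "qOU_radius q - d < y"
    define \<delta> where "\<delta> = t - s"
    have \<delta>: "0 < \<delta>" "\<delta> < d" using st by (auto simp: \<delta>_def)
    have "dist (\<delta>, x, y) p0 \<le> dist \<delta> 0 + (dist x (- qOU_radius q) + dist y (qOU_radius q))"
      unfolding p0_def dist_norm diff_Pair
      by (rule order_trans[OF norm_Pair_le add_left_mono[OF norm_Pair_le]])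
    also have "\<dots> < e"
      using \<delta> x y by (auto simp: d_def dist_real_def qOU_state_space_eq)
    finally have *: "qOU_phi_prod q \<delta> x y \<noteq> 0" "\<bar>J \<delta> x y - qOU_jump_rate q\<bar> < \<eta>"
      using J[of \<delta> x y] \<delta> x(1) y(1) by (auto simp: K_def p0_def d_def)
    have "qOU_transition_density q s t x y = J \<delta> x y * (\<delta> * qOU_density q y)"
      unfolding qOU_transition_density_eq[OF assms(1) st(1) x(1)] J_def \<delta>_def[symmetric]
      using \<delta> by simp
    moreover have "0 \<le> \<delta> * qOU_density q y"
      using \<delta> qOU_density_nonneg[OF assms(1)] by simp
    ultimately show "qOU_phi_prod q (t - s) x y \<noteq> 0 \<and>
      (qOU_jump_rate q - \<eta>) * (t - s) * qOU_density q y \<le> qOU_transition_density q s t x y \<and>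
      qOU_transition_density q s t x y \<le> (qOU_jump_rate q + \<eta>) * (t - s) * qOU_density q y"
      using * unfolding \<delta>_def[symmetric] mult.assoc by (auto intro!: mult_right_mono)
  qed
qed

section \<open>Mass near a square-root zero\<close>

lemma integral_sqrt_edge:
  fixes b \<epsilon> :: real
  assumes "0 \<le> \<epsilon>"
  shows "((\<lambda>y. sqrt (b - y)) has_integral 2 / 3 * (\<epsilon> * sqrt \<epsilon>)) {b - \<epsilon>..b}"
proof -
  let ?F = "\<lambda>y. - (2 / 3 * ((b - y) * sqrt (b - y)))"
  have "((\<lambda>y. sqrt (b - y)) has_integral ?F b - ?F (b - \<epsilon>)) {b - \<epsilon>..b}"
  \<comment> \<open>The rule for differentiating \<open>sqrt\<close> fails at \<open>y = b\<close>,
    so only interior points are differentiated.\<close>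
  proof (rule fundamental_theorem_of_calculus_interior)
    show "continuous_on {b - \<epsilon>..b} ?F" by (intro continuous_intros)
    fix y assume y: "y \<in> {b - \<epsilon><..<b}"
    then have "(?F has_real_derivative sqrt (b - y)) (at y)"
      by (auto intro!: derivative_eq_intros simp: field_simps)
        (use y in \<open>simp add: mult.assoc[symmetric]\<close>)
    then show "(?F has_vector_derivative sqrt (b - y)) (at y)"
      by (simp add: has_real_derivative_iff_has_vector_derivative)
  qed (use assms in auto)
  then show ?thesis by simp
qed

text \<open>Near \<open>b\<close> the function \<open>c\<close> is within \<eta> of
  \<open>c b\<close>, so the integral is squeezed between multiples of the total weight
  \<open>w\<close>, which is \<open>2 / 3\<close> of \<epsilon> to the power 3/2. The relative error
  is then at most \<open>2 / 3 * \<eta>\<close>.\<close>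

lemma edge_integral_tendsto:
  fixes c :: "real \<Rightarrow> real"
  assumes "a < b" and cont: "continuous_on {a..b} c"
  shows "((\<lambda>\<epsilon>. (LINT y:{b - \<epsilon>..b}|lborel. sqrt (b - y) * c y) / (\<epsilon> * sqrt \<epsilon>)) \<longlongrightarrow> 2 / 3 * c b)
           (at_right 0)"
proof (rule tendstoI)
  fix \<eta> :: real assume "0 < \<eta>"
  have "(c \<longlongrightarrow> c b) (at b within {a..b})"
    using assms by (auto simp: continuous_on_def)
  then have "\<forall>\<^sub>F y in at b within {a..b}. dist (c y) (c b) < \<eta>"
    using \<open>0 < \<eta>\<close> by (rule tendstoD)
  then obtain d where d: "0 < d" "\<And>y. \<lbrakk>y \<in> {a..b}; dist y b < d; y \<noteq> b\<rbrakk> \<Longrightarrow> \<bar>c y - c b\<bar> < \<eta>"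
    unfolding eventually_at by (auto simp: dist_real_def)
  have "\<forall>\<^sub>F \<epsilon> in at_right 0. \<epsilon> < min d (b - a)"
    using d(1) assms(1) by (intro eventually_at_rightI[of 0 "min d (b - a)"]) auto
  moreover have "\<forall>\<^sub>F \<epsilon> in at_right (0::real). 0 < \<epsilon>"
    by (auto simp: eventually_at_filter)
  ultimately show "\<forall>\<^sub>F \<epsilon> in at_right 0.
      dist ((LINT y:{b - \<epsilon>..b}|lborel. sqrt (b - y) * c y) / (\<epsilon> * sqrt \<epsilon>)) (2 / 3 * c b) < \<eta>"
  proof eventually_elim
    case (elim \<epsilon>)
    let ?S = "{b - \<epsilon>..b}"
    define w where "w = 2 / 3 * (\<epsilon> * sqrt \<epsilon>)"
    have w: "0 < w" using elim by (simp add: w_def)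
    have sub: "?S \<subseteq> {a..b}" using elim by auto
    have close: "\<bar>c y - c b\<bar> \<le> \<eta>" if "y \<in> ?S" for y
      using d(2)[of y] that elim \<open>0 < \<eta>\<close> by (cases "y = b") (auto simp: dist_real_def)
    have int1: "set_integrable lborel ?S (\<lambda>y. sqrt (b - y) * k)" for k
      by (intro borel_integrable_atLeastAtMost' continuous_intros)
    have int2: "set_integrable lborel ?S (\<lambda>y. sqrt (b - y) * c y)"
      by (intro borel_integrable_atLeastAtMost' continuous_intros continuous_on_subset[OF cont sub])
    have I1: "(LINT y:?S|lborel. sqrt (b - y) * k) = w * k" for k
    proof -
      have "(LINT y:?S|lborel. sqrt (b - y)) = w"
        using set_borel_integral_eq_integral(2)[OF int1[of 1]] integral_unique[OF integral_sqrt_edge[of \<epsilon> b]] elim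
        by (simp add: w_def)
      then show ?thesis by simp
    qed
    have "(LINT y:?S|lborel. sqrt (b - y) * c y) \<le> (LINT y:?S|lborel. sqrt (b - y) * (c b + \<eta>))"
      using close by (intro set_integral_mono int1 int2 mult_left_mono) (auto simp: abs_le_iff algebra_simps)
    moreover have "(LINT y:?S|lborel. sqrt (b - y) * (c b - \<eta>)) \<le> (LINT y:?S|lborel. sqrt (b - y) * c y)"
      using close by (intro set_integral_mono int1 int2 mult_left_mono) (auto simp: abs_le_iff algebra_simps)
    ultimately have "\<bar>(LINT y:?S|lborel. sqrt (b - y) * c y) - w * c b\<bar> \<le> w * \<eta>"
      unfolding I1 by (simp only: distrib_left right_diff_distrib abs_le_iff) linarith
    then have "\<bar>(LINT y:?S|lborel. sqrt (b - y) * c y) - w * c b\<bar> / (\<epsilon> * sqrt \<epsilon>) \<le> w * \<eta> / (\<epsilon> * sqrt \<epsilon>)"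
      using elim by (intro divide_right_mono) auto
    also have "\<dots> = 2 / 3 * \<eta>" using elim by (simp add: w_def)
    also have "\<dots> < \<eta>" using \<open>0 < \<eta>\<close> by simp
    finally show ?case
    proof -
      have "(LINT y:?S|lborel. sqrt (b - y) * c y) / (\<epsilon> * sqrt \<epsilon>) - 2 / 3 * c b
          = ((LINT y:?S|lborel. sqrt (b - y) * c y) - w * c b) / (\<epsilon> * sqrt \<epsilon>)"
        using elim by (simp add: w_def diff_divide_distrib)
      moreover assume "\<bar>(LINT y:?S|lborel. sqrt (b - y) * c y) - w * c b\<bar> / (\<epsilon> * sqrt \<epsilon>) < \<eta>"
      ultimately show ?thesis
        using elim by (simp add: dist_real_def abs_divide abs_mult)
    qed
  qed
qed

subsection \<open>Jumps of cadlag functions along a grid\<close>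

definition grid_jump :: "(real \<Rightarrow> real) \<Rightarrow> real \<Rightarrow> real \<Rightarrow> nat \<Rightarrow> bool" where
  "grid_jump f a b n \<longleftrightarrow> (\<exists>i<n. f (real i / real n) < a \<and> b < f (real (Suc i) / real n))"

lemma cadlag_left_limit:
  assumes "cadlag f" "0 < t"
  shows "(f \<longlongrightarrow> left_limit f t) (at_left t)"
proof -
  obtain l where l: "(f \<longlongrightarrow> l) (at_left t)"
    using assms by (auto simp: cadlag_def)
  then have "left_limit f t = l"
    unfolding left_limit_def by (intro tendsto_Lim) auto
  with l show ?thesis by simp
qed

text \<open>On a fine grid, the mesh interval containing \<open>t\<close> has its left end where
  \<open>f\<close> is close to its left limit and its right end where \<open>f\<close> is close to
  \<open>f t\<close>.\<close>

lemma cadlag_jump_imp_grid_jump: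
  assumes f: "cadlag f" and t: "0 < t" "t \<le> 1" and jump: "left_limit f t < a" "b < f t"
  shows "\<forall>\<^sub>F n in sequentially. grid_jump f a b n"
proof -
  have "\<forall>\<^sub>F s in at_left t. f s < a"
    using cadlag_left_limit[OF f t(1)] jump(1) by (rule order_tendstoD)
  then obtain u where u: "u < t" "\<And>s. \<lbrakk>u < s; s < t\<rbrakk> \<Longrightarrow> f s < a"
    by (auto simp: eventually_at_left_real[OF t(1)] eventually_at_left[OF t(1)])
  have "(f \<longlongrightarrow> f t) (at_right t)"
    using f t by (auto simp: cadlag_def)
  then have "\<forall>\<^sub>F s in at_right t. b < f s"
    using jump(2) by (rule order_tendstoD)
  then obtain v where v: "t < v" "\<And>s. \<lbrakk>t < s; s < v\<rbrakk> \<Longrightarrow> b < f s"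
    by (auto simp: eventually_at_right[of t "t + 1"])
  define d where "d = min (t - u) (v - t)"
  have d: "0 < d" using u v by (simp add: d_def)
  have "\<forall>\<^sub>F n in sequentially. 1 / real n < d"
    using d by real_asymp
  then show ?thesis
    using eventually_gt_at_top[of 0]
  proof eventually_elim
    case (elim n)
    \<comment> \<open>The ceiling selects the interval open on the left and closed on the right, so
      the left grid point is strictly before \<open>t\<close>, even if \<open>t\<close> is itself a
      grid point.\<close>
    define m where "m = nat \<lceil>t * real n\<rceil>"
    have tn: "0 < t * real n" using t elim by simp
    have m: "t * real n \<le> real m" "real m < t * real n + 1"
      using tn by (auto simp: m_def) linarith+
    have "m > 0" using m tn by (cases m) auto
    then obtain i where i: "m = Suc i" by (cases m) auto
    have "t * real n \<le> real n" using t elim by simp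
    then have "i < n" using m i by linarith
    have 1: "real i / real n < t" "t \<le> real (Suc i) / real n"
      using m i elim by (auto simp: field_simps)
    have 2: "real (Suc i) / real n = real i / real n + 1 / real n"
      by (simp add: add_divide_distrib)
    have "f (real i / real n) < a"
      using 1 2 elim by (intro u) (auto simp: d_def)
    \<comment> \<open>The right grid point may coincide with \<open>t\<close>, where right-hand
      neighbourhoods give nothing and \<open>jump(2)\<close> itself is used.\<close>
    moreover have "b < f (real (Suc i) / real n)"
      using 1 2 elim jump(2) v(2)[of "real (Suc i) / real n"]
      by (cases "real (Suc i) / real n = t") (auto simp: d_def)
    ultimately show ?case
      using \<open>i < n\<close> by (auto simp: grid_jump_def)
  qed
qed

text \<open>By compactness the passages along a subsequence accumulate at some \<open>t\<close>.
  Since \<open>a < b\<close>, a one-sided limit of \<open>f\<close> cannot accommodate values below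
  \<open>a\<close> and above \<open>b\<close> at once, so close pairs must straddle
  \<open>t\<close>. In the limit the strict inequalities become weak.\<close>

lemma frequently_grid_jump_imp_jump:
  assumes f: "cadlag f" and "a < b" and freq: "\<exists>\<^sub>F n in sequentially. grid_jump f a b n"
  shows "\<exists>t\<in>{0<..1}. left_limit f t \<le> a \<and> b \<le> f t"
proof -
  obtain r :: "nat \<Rightarrow> nat" where r: "strict_mono r" "\<And>k. grid_jump f a b (r k)"
    using freq unfolding frequently_sequentially
    by (metis infinite_enumerate infinite_nat_iff_unbounded_le mem_Collect_eq)
  then obtain i where i: "\<And>k. i k < r k" "\<And>k. f (real (i k) / real (r k)) < a"
      "\<And>k. b < f (real (Suc (i k)) / real (r k))"
    unfolding grid_jump_def by metis
  define s where "s = (\<lambda>k. real (i k) / real (r k))"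
  have r0: "0 < r k" for k using i(1)[of k] by simp
  have "s k \<in> {0..1}" for k
    using i(1)[of k] by (auto simp: s_def)
  then obtain t g where t: "t \<in> {0..1}" "strict_mono g" "(s \<circ> g) \<longlonglongrightarrow> t"
    using compact_Icc[of 0 "1::real"] unfolding compact_def by metis
  define u where "u = (\<lambda>k. real (Suc (i (g k))) / real (r (g k)))"
  have u_eq: "u k = s (g k) + 1 / real (r (g k))" for k
    by (simp add: u_def s_def add_divide_distrib)
  have "strict_mono (r \<circ> g)" by (rule strict_mono_o) fact+
  then have "filterlim (\<lambda>k. r (g k)) at_top sequentially"
    using filterlim_subseq by (auto simp: o_def)
  then have "(\<lambda>k. 1 / real (r (g k))) \<longlonglongrightarrow> 0"
    by (rule filterlim_compose[rotated]) real_asymp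
  then have "(\<lambda>k. s (g k) + 1 / real (r (g k))) \<longlonglongrightarrow> t + 0"
    using t(3) by (intro tendsto_add) (auto simp: o_def)
  then have u: "u \<longlonglongrightarrow> t" by (simp add: u_eq[abs_def])
  \<comment> \<open>All that is retained of the grid: ordered pairs arbitrarily close to
    \<open>t\<close>.\<close>
  have near: "\<exists>x y. \<bar>x - t\<bar> < d \<and> \<bar>y - t\<bar> < d \<and> 0 \<le> x \<and> x < y \<and> f x < a \<and> b < f y"
    if "0 < d" for d
  proof -
    have "\<forall>\<^sub>F k in sequentially. dist (s (g k)) t < d" "\<forall>\<^sub>F k in sequentially. dist (u k) t < d"
      using t(3) u that by (auto simp: o_def dest: tendstoD)
    then have "\<forall>\<^sub>F k in sequentially. \<bar>s (g k) - t\<bar> < d \<and> \<bar>u k - t\<bar> < d"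
      by eventually_elim (auto simp: dist_real_def)
    then obtain k where "\<bar>s (g k) - t\<bar> < d" "\<bar>u k - t\<bar> < d"
      by (auto simp: eventually_sequentially)
    moreover have "f (s (g k)) < a" "b < f (u k)"
      using i by (auto simp: s_def u_def)
    moreover have "0 \<le> s (g k)" "s (g k) < u k"
      using r0 by (auto simp: u_eq) (simp add: s_def)
    ultimately show ?thesis by blast
  qed
  have right: "\<exists>d>0. \<forall>s. t \<le> s \<and> s < t + d \<longrightarrow> P (f s)"
    if "open {x. P x}" "P (f t)" for P
  proof -
    have "(f \<longlongrightarrow> f t) (at_right t)"
      using f t by (auto simp: cadlag_def)
    then have "\<forall>\<^sub>F s in at_right t. f s \<in> {x. P x}"
      by (rule topological_tendstoD) (use that in auto)
    then obtain v where v: "t < v" "\<And>s. \<lbrakk>t < s; s < v\<rbrakk> \<Longrightarrow> P (f s)"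
      by (auto simp: eventually_at_right[of t "t + 1"])
    then show ?thesis
      using that(2) by (intro exI[of _ "v - t"]) (auto simp: le_less)
  qed
  have left: "\<exists>d>0. \<forall>s. t - d < s \<and> s < t \<longrightarrow> P (f s)"
    if "open {x. P x}" "P (left_limit f t)" "0 < t" for P
  proof -
    have "\<forall>\<^sub>F s in at_left t. f s \<in> {x. P x}"
      using cadlag_left_limit[OF f \<open>0 < t\<close>] by (rule topological_tendstoD) (use that in auto)
    then obtain v where v: "v < t" "\<And>s. \<lbrakk>v < s; s < t\<rbrakk> \<Longrightarrow> P (f s)"
      by (auto simp: eventually_at_left[OF \<open>0 < t\<close>])
    then show ?thesis
      by (intro exI[of _ "t - v"]) auto
  qed
  show ?thesis
  proof (cases "0 < t")
    \<comment> \<open>At time 0 both points of a pair lie on the right, where there is only the one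
      limit \<open>f 0\<close>; this contradicts \<open>a < b\<close>.\<close>
    case False
    then have "t = 0" using t by simp
    consider "a < f t" | "f t < b" using \<open>a < b\<close> by linarith
    then show ?thesis
    proof cases
      case 1
      obtain d where d: "d > 0" "\<And>x. t \<le> x \<and> x < t + d \<Longrightarrow> a < f x"
        using right[of "\<lambda>x. a < x"] 1 by (auto simp: open_Collect_less)
      obtain x y where "\<bar>x - t\<bar> < d" "\<bar>y - t\<bar> < d" "0 \<le> x" "x < y" "f x < a" "b < f y"
        using near[of d] d(1) by auto
      then show ?thesis using d(1) d(2)[of x] d(2)[of y] \<open>t = 0\<close> by (smt (verit))
    next
      case 2
      obtain d where d: "d > 0" "\<And>x. t \<le> x \<and> x < t + d \<Longrightarrow> f x < b"
        using right[of "\<lambda>x. x < b"] 2 by (auto simp: open_Collect_less)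
      obtain x y where "\<bar>x - t\<bar> < d" "\<bar>y - t\<bar> < d" "0 \<le> x" "x < y" "f x < a" "b < f y"
        using near[of d] d(1) by auto
      then show ?thesis using d(1) d(2)[of x] d(2)[of y] \<open>t = 0\<close> by (smt (verit))
    qed
  next
    case True
    \<comment> \<open>Otherwise \<open>f\<close> stays below \<open>b\<close> just after
      \<open>t\<close>, so both points of a close pair precede \<open>t\<close> and compete for the
      same left limit.\<close>
    have "b \<le> f t"
    proof (rule ccontr)
      assume "\<not> b \<le> f t"
      then obtain d where d: "d > 0" "\<And>x. t \<le> x \<and> x < t + d \<Longrightarrow> f x < b"
        using right[of "\<lambda>x. x < b"] by (auto simp: open_Collect_less)
      consider "a < left_limit f t" | "left_limit f t < b" using \<open>a < b\<close> by linarith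
      then show False
      proof cases
        case 1
        then obtain e where e: "e > 0" "\<And>x. t - e < x \<and> x < t \<Longrightarrow> a < f x"
          using left[of "\<lambda>x. a < x"] True by (auto simp: open_Collect_less)
        obtain x y where "\<bar>x - t\<bar> < min d e" "\<bar>y - t\<bar> < min d e" "0 \<le> x" "x < y" "f x < a" "b < f y"
          using near[of "min d e"] d(1) e(1) by auto
        then show False using d(1) d(2)[of x] d(2)[of y] e(1) e(2)[of x] e(2)[of y] by (smt (verit))
      next
        case 2
        then obtain e where e: "e > 0" "\<And>x. t - e < x \<and> x < t \<Longrightarrow> f x < b"
          using left[of "\<lambda>x. x < b"] True by (auto simp: open_Collect_less)
        obtain x y where "\<bar>x - t\<bar> < min d e" "\<bar>y - t\<bar> < min d e" "0 \<le> x" "x < y" "f x < a" "b < f y"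
          using near[of "min d e"] d(1) e(1) by auto
        then show False using d(1) d(2)[of x] d(2)[of y] e(1) e(2)[of x] e(2)[of y] by (smt (verit))
      qed
    qed
    \<comment> \<open>Otherwise \<open>f\<close> exceeds \<open>a\<close> on both sides of
      \<open>t\<close>, as \<open>f t\<close> is at least \<open>b\<close>, and no place is left for
      \<open>x\<close>.\<close>
    moreover have "left_limit f t \<le> a"
    proof (rule ccontr)
      assume "\<not> left_limit f t \<le> a"
      then obtain e where e: "e > 0" "\<And>x. t - e < x \<and> x < t \<Longrightarrow> a < f x"
        using left[of "\<lambda>x. a < x"] True by (auto simp: open_Collect_less)
      have "a < f t" using \<open>b \<le> f t\<close> \<open>a < b\<close> by simp
      then obtain d where d: "d > 0" "\<And>x. t \<le> x \<and> x < t + d \<Longrightarrow> a < f x"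
        using right[of "\<lambda>x. a < x"] by (auto simp: open_Collect_less)
      obtain x y where "\<bar>x - t\<bar> < min d e" "\<bar>y - t\<bar> < min d e" "0 \<le> x" "x < y" "f x < a" "b < f y"
        using near[of "min d e"] d(1) e(1) by auto
      then show False using d(1) d(2)[of x] d(2)[of y] e(1) e(2)[of x] e(2)[of y] by (smt (verit))
    qed
    ultimately show ?thesis
      using t True by auto
  qed
qed

subsection \<open>The process\<close>

lemma limsup_iff_frequently: "x \<in> (\<Inter>N. \<Union>n\<in>{N..}. B n) \<longleftrightarrow> (\<exists>\<^sub>F n in sequentially. x \<in> B n)"
  by (auto simp: frequently_sequentially)

lemma liminf_iff_eventually: "x \<in> (\<Union>N. \<Inter>n\<in>{N..}. B n) \<longleftrightarrow> (\<forall>\<^sub>F n in sequentially. x \<in> B n)"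
  by (auto simp: eventually_sequentially)

text \<open>Fatou for events, with an eventual bound in place of a limit: the probabilities of the
  grid events are only known to be squeezed, not to converge.\<close>

lemma (in finite_measure) measure_liminf_le:
  assumes B: "\<And>n. B n \<in> sets M" and "\<forall>\<^sub>F n in sequentially. measure M (B n) \<le> b"
  shows "measure M (\<Union>N. \<Inter>n\<in>{N..}. B n) \<le> b"
proof (rule LIMSEQ_le_const2)
  have "incseq (\<lambda>N. \<Inter>n\<in>{N..}. B n)"
    by (auto simp: incseq_def)
  then show "(\<lambda>N. measure M (\<Inter>n\<in>{N..}. B n)) \<longlonglongrightarrow> measure M (\<Union>N. \<Inter>n\<in>{N..}. B n)"
    by (intro finite_Lim_measure_incseq) (auto intro!: sets.countable_INT' B)
  obtain N0 where N0: "\<And>n. N0 \<le> n \<Longrightarrow> measure M (B n) \<le> b"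
    using assms(2) by (auto simp: eventually_sequentially)
  have "measure M (\<Inter>n\<in>{N..}. B n) \<le> b" if "N0 \<le> N" for N
  proof -
    have "measure M (\<Inter>n\<in>{N..}. B n) \<le> measure M (B N)"
      by (intro finite_measure_mono B) auto
    also have "\<dots> \<le> b" using N0 that .
    finally show ?thesis .
  qed
  then show "\<exists>N. \<forall>n\<ge>N. measure M (\<Inter>n\<in>{n..}. B n) \<le> b"
    by blast
qed

text \<open>The counterpart for decreasing tails; continuity from above rests on the finiteness of
  the measure.\<close>

lemma (in finite_measure) measure_limsup_ge:
  assumes B: "\<And>n. B n \<in> sets M" and "\<forall>\<^sub>F n in sequentially. b \<le> measure M (B n)"
  shows "b \<le> measure M (\<Inter>N. \<Union>n\<in>{N..}. B n)"
proof (rule LIMSEQ_le_const)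
  have "decseq (\<lambda>N. \<Union>n\<in>{N..}. B n)"
    by (fastforce simp: decseq_def)
  then show "(\<lambda>N. measure M (\<Union>n\<in>{N..}. B n)) \<longlonglongrightarrow> measure M (\<Inter>N. \<Union>n\<in>{N..}. B n)"
    by (intro finite_Lim_measure_decseq) (auto intro!: sets.countable_UN' B)
  obtain N0 where N0: "\<And>n. N0 \<le> n \<Longrightarrow> b \<le> measure M (B n)"
    using assms(2) by (auto simp: eventually_sequentially)
  have "b \<le> measure M (\<Union>n\<in>{N..}. B n)" if "N0 \<le> N" for N
  proof -
    have "b \<le> measure M (B N)" using N0 that .
    also have "\<dots> \<le> measure M (\<Union>n\<in>{N..}. B n)"
      by (intro finite_measure_mono sets.countable_UN') (auto intro: B)
    finally show ?thesis .
  qed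
  then show "\<exists>N. \<forall>n\<ge>N. b \<le> measure M (\<Union>n\<in>{n..}. B n)"
    by blast
qed

text \<open>This collects what the estimates on grids use. The cadlag property enters as a
  hypothesis of the later lemmas on paths.\<close>

locale qOU = prob_space M for M :: "'a measure" +
  fixes q :: real and X :: "real \<Rightarrow> 'a \<Rightarrow> real"
  assumes q_bounds: "\<bar>q\<bar> < 1" and process: "qOU_process q M X"
begin

abbreviation R :: real where "R \<equiv> qOU_radius q"
abbreviation \<kappa> :: real where "\<kappa> \<equiv> qOU_jump_rate q"

lemma R_pos: "0 < R"
  using q_bounds by (intro qOU_radius_pos) auto

lemma measurable_X [measurable]: "0 \<le> t \<Longrightarrow> X t \<in> borel_measurable M"
  using process by (auto simp: qOU_process_def measurable_restrict_space2_iff)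

lemma X_in_state_space: "\<lbrakk>0 \<le> t; \<omega> \<in> space M\<rbrakk> \<Longrightarrow> X t \<omega> \<in> qOU_state_space q"
  using process by (auto simp: qOU_process_def measurable_restrict_space2_iff)

lemma distributed_X: "0 \<le> t \<Longrightarrow> distributed M lborel (X t) (\<lambda>x. ennreal (qOU_density q x))"
  using process by (auto simp: qOU_process_def)

text \<open>Measurability, and below integrability, are inherited from the law of \<open>X 0\<close>
  instead of being computed from the infinite product.\<close>

lemma measurable_density [measurable]: "qOU_density q \<in> borel_measurable borel"
  using distributed_real_measurable[OF _ distributed_X[of 0]] qOU_density_nonneg[OF q_bounds] by auto

lemma integrable_density: "integrable lborel (qOU_density q)"
proof (rule integrableI_nonneg)
  have "(\<integral>\<^sup>+y. ennreal (qOU_density q y) \<partial>lborel) = emeasure M (space M)"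
    using distributed_emeasure[OF distributed_X[of 0], of UNIV] by simp
  then show "(\<integral>\<^sup>+y. ennreal (qOU_density q y) \<partial>lborel) < \<infinity>"
    using emeasure_space_1 by simp
qed (use qOU_density_nonneg[OF q_bounds] in auto)

lemma prob_X:
  assumes "0 \<le> t" "B \<in> sets borel"
  shows "prob {\<omega> \<in> space M. X t \<omega> \<in> B} = (LINT y:B|lborel. qOU_density q y)"
proof -
  have "emeasure M (X t -` B \<inter> space M) = (\<integral>\<^sup>+y. ennreal (qOU_density q y) * indicator B y \<partial>lborel)"
    using distributed_emeasure[OF distributed_X[OF assms(1)]] assms(2) by simp
  also have "\<dots> = (\<integral>\<^sup>+y. ennreal (indicator B y * qOU_density q y) \<partial>lborel)"
    by (intro nn_integral_cong) (auto split: split_indicator)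
  also have "\<dots> = ennreal (LINT y:B|lborel. qOU_density q y)"
    unfolding set_lebesgue_integral_def real_scaleR_def
    using integrable_mult_indicator[OF _ integrable_density, of B] assms(2) qOU_density_nonneg[OF q_bounds]
    by (intro nn_integral_eq_integral) auto
  finally have "emeasure M (X t -` B \<inter> space M) = ennreal (LINT y:B|lborel. qOU_density q y)" .
  moreover have "0 \<le> (LINT y:B|lborel. qOU_density q y)"
    using qOU_density_nonneg[OF q_bounds] by (auto simp: set_lebesgue_integral_def intro!: integral_nonneg)
  moreover have "X t -` B \<inter> space M = {\<omega> \<in> space M. X t \<omega> \<in> B}" by auto
  ultimately show ?thesis
    by (simp add: measure_def)
qed

section \<open>Stationary mass of the two edges\<close>

definition edge_mass :: "real \<Rightarrow> real" where
  "edge_mass \<epsilon> = (LINT y:{R - \<epsilon><..}|lborel. qOU_density q y)"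

lemma prob_upper_edge: "0 \<le> t \<Longrightarrow> prob {\<omega> \<in> space M. R - \<epsilon> < X t \<omega>} = edge_mass \<epsilon>"
  using prob_X[of t "{R - \<epsilon><..}"] by (simp add: edge_mass_def)

lemma prob_lower_edge:
  assumes "0 \<le> t"
  shows "prob {\<omega> \<in> space M. X t \<omega> < - R + \<epsilon>} = edge_mass \<epsilon>"
proof -
  have "edge_mass \<epsilon> = (LINT y:{y. - y \<in> {R - \<epsilon><..}}|lborel. qOU_density q (- y))"
    unfolding edge_mass_def by (rule set_integral_reflect)
  also have "{y. - y \<in> {R - \<epsilon><..}} = {..<- R + \<epsilon>}" by auto
  finally show ?thesis
    using prob_X[of t "{..<- R + \<epsilon>}"] assms by (simp add: qOU_density_minus)
qed

lemma edge_mass_nonneg: "0 \<le> edge_mass \<epsilon>"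
  using measure_nonneg prob_upper_edge[of 0 \<epsilon>] by (metis order_refl)

lemma edge_mass_tendsto:
  "((\<lambda>\<epsilon>. edge_mass \<epsilon> / (\<epsilon> * sqrt \<epsilon>)) \<longlongrightarrow> 2 / 3 * qOU_edge q R) (at_right 0)"
proof -
  have q1: "q < 1" using q_bounds by auto
  have "continuous_on {- R..R} (qOU_edge q)"
    using continuous_on_qOU_edge[OF q_bounds] by (simp add: qOU_state_space_eq)
  then have "((\<lambda>\<epsilon>. (LINT y:{R - \<epsilon>..R}|lborel. sqrt (R - y) * qOU_edge q y) / (\<epsilon> * sqrt \<epsilon>)) \<longlongrightarrow> 2 / 3 * qOU_edge q R) (at_right 0)"
    using R_pos by (intro edge_integral_tendsto[of "- R"]) auto
  moreover have "\<forall>\<^sub>F \<epsilon> in at_right 0. (LINT y:{R - \<epsilon>..R}|lborel. sqrt (R - y) * qOU_edge q y) = edge_mass \<epsilon>"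
  proof -
    have "(LINT y:{R - \<epsilon>..R}|lborel. sqrt (R - y) * qOU_edge q y) = edge_mass \<epsilon>"
      if \<epsilon>: "0 < \<epsilon>" "\<epsilon> < R" for \<epsilon>
    proof -
      have "(LINT y:{R - \<epsilon>..R}|lborel. sqrt (R - y) * qOU_edge q y) = (LINT y:{R - \<epsilon>..}|lborel. qOU_density q y)"
        unfolding set_lebesgue_integral_def
        by (rule Bochner_Integration.integral_cong)
          (use \<epsilon> in \<open>auto simp: qOU_density_eq[OF q1] qOU_state_space_eq split: split_indicator\<close>)
      \<comment> \<open>Closed and open half-lines differ by a single point, a null set.\<close>
      also have "\<dots> = edge_mass \<epsilon>"
        unfolding edge_mass_def
      proof (intro set_integral_null_delta integrable_density)
        have "({R - \<epsilon>..} - {R - \<epsilon><..}) \<union> ({R - \<epsilon><..} - {R - \<epsilon>..}) = {R - \<epsilon>}"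
          by auto
        then show "({R - \<epsilon>..} - {R - \<epsilon><..}) \<union> ({R - \<epsilon><..} - {R - \<epsilon>..}) \<in> null_sets lborel"
          by (simp add: finite_imp_null_set_lborel)
      qed auto
      finally show ?thesis .
    qed
    then show ?thesis
      using R_pos by (intro eventually_at_rightI[of 0 R]) auto
  qed
  ultimately show ?thesis
    by (rule Lim_transform_eventually[OF _ eventually_mono]) auto
qed

section \<open>Natural filtration and one-step estimates\<close>

lemma space_natural_past: "space (natural_past M X s) = space M"
  by (simp add: natural_past_def space_measure_of_conv)

lemma sets_natural_past:
  "sets (natural_past M X s)
     = sigma_sets (space M) {X u -` B \<inter> space M | u B. 0 \<le> u \<and> u \<le> s \<and> B \<in> sets borel}"
  unfolding natural_past_def by (rule sets_measure_of) auto

lemma subalgebra_natural_past: "subalgebra M (natural_past M X s)"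
  unfolding subalgebra_def space_natural_past
proof (intro conjI refl)
  show "sets (natural_past M X s) \<subseteq> sets M"
    unfolding sets_natural_past
    by (rule sets.sigma_sets_subset) (auto intro!: measurable_sets)
qed

lemma natural_past_mono: "s \<le> t \<Longrightarrow> sets (natural_past M X s) \<subseteq> sets (natural_past M X t)"
  unfolding sets_natural_past by (intro sigma_sets_mono') fastforce

lemma vimage_in_natural_past:
  assumes "0 \<le> u" "u \<le> s" "B \<in> sets borel"
  shows "{\<omega> \<in> space M. X u \<omega> \<in> B} \<in> sets (natural_past M X s)"
proof -
  have "{\<omega> \<in> space M. X u \<omega> \<in> B} = X u -` B \<inter> space M" by auto
  then show ?thesis
    unfolding sets_natural_past using assms by (intro sigma_sets.Basic) blast
qed

text \<open>The Markov property integrated over a past event. The conditional expectation serves as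
  \<open>g\<close>, because it is integrable by construction, whereas measurability of
  \<open>h\<close> has not been established; the two agree almost everywhere.\<close>

lemma markov:
  assumes st: "0 \<le> s" "s < t" and E: "E \<in> sets (natural_past M X s)" and B: "B \<in> sets borel"
  defines "h \<equiv> (\<lambda>x. LINT y:B|lborel. qOU_transition_density q s t x y)"
  obtains g where "AE \<omega> in M. g \<omega> = h (X s \<omega>)" "set_integrable M E g"
    "prob (E \<inter> {\<omega> \<in> space M. X t \<omega> \<in> B}) = (LINT \<omega>:E|M. g \<omega>)"
proof
  have sub: "subalgebra M (natural_past M X s)" by (rule subalgebra_natural_past)
  interpret F: sigma_finite_subalgebra M "natural_past M X s"
    by (intro finite_measure_subalgebra_is_sigma_finite finite_measure_subalgebra.intro
        finite_measure_subalgebra_axioms.intro sub) unfold_locales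
  let ?A = "X t -` B \<inter> space M"
  have A: "?A \<in> sets M" using st B by (auto intro!: measurable_sets)
  have EM: "E \<in> sets M" using E sub by (auto simp: subalgebra_def)
  let ?g = "real_cond_exp M (natural_past M X s) (indicator ?A)"
  show "AE \<omega> in M. ?g \<omega> = h (X s \<omega>)"
    using process st B by (auto simp: qOU_process_def h_def)
  have int: "integrable M (indicator ?A :: _ \<Rightarrow> real)"
    using A by (simp add: emeasure_eq_measure)
  show "set_integrable M E ?g"
    unfolding set_integrable_def using EM F.real_cond_exp_int(1)[OF int]
    by (rule integrable_mult_indicator)
  have "(LINT \<omega>:E|M. indicator ?A \<omega>) = (LINT \<omega>:E|M. ?g \<omega>)"
    using int E by (rule F.real_cond_exp_intA)
  moreover have "(LINT \<omega>:E|M. indicator ?A \<omega>) = prob (E \<inter> ?A)"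
  proof -
    have "(LINT \<omega>:E|M. indicator ?A \<omega> :: real) = (LINT \<omega>|M. indicator (E \<inter> ?A) \<omega>)"
      unfolding set_lebesgue_integral_def by (simp add: indicator_inter_arith)
    then show ?thesis using A EM by simp
  qed
  moreover have "?A = {\<omega> \<in> space M. X t \<omega> \<in> B}" by auto
  ultimately show "prob (E \<inter> {\<omega> \<in> space M. X t \<omega> \<in> B}) = (LINT \<omega>:E|M. ?g \<omega>)"
    by simp
qed

text \<open>The corner estimate is integrated first over \<open>y\<close>, giving
  \<open>edge_mass\<close>, and then over the past event \<open>E\<close>. An arbitrary
  \<open>E\<close> is allowed so that it can be the lower edge alone or its intersection with an
  earlier passage.\<close>

lemma step_bounds:
  assumes "0 < \<eta>"
  obtains d where "0 < d" "d < R"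
    "\<And>s t \<epsilon> E. \<lbrakk>0 \<le> s; s < t; t < s + d; 0 < \<epsilon>; \<epsilon> \<le> d; E \<in> sets (natural_past M X s);
        E \<subseteq> {\<omega> \<in> space M. X s \<omega> < - R + \<epsilon>}\<rbrakk> \<Longrightarrow>
      (\<kappa> - \<eta>) * (t - s) * edge_mass \<epsilon> * prob E \<le> prob (E \<inter> {\<omega> \<in> space M. R - \<epsilon> < X t \<omega>}) \<and>
      prob (E \<inter> {\<omega> \<in> space M. R - \<epsilon> < X t \<omega>}) \<le> (\<kappa> + \<eta>) * (t - s) * edge_mass \<epsilon> * prob E"
proof -
  obtain e where e: "0 < e" "e < 1" and bounds:
    "\<And>s t x y. \<lbrakk>s < t; t < s + e; x \<in> qOU_state_space q; x < - R + e;
        y \<in> qOU_state_space q; R - e < y\<rbrakk> \<Longrightarrow>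
      qOU_phi_prod q (t - s) x y \<noteq> 0 \<and>
      (\<kappa> - \<eta>) * (t - s) * qOU_density q y \<le> qOU_transition_density q s t x y \<and>
      qOU_transition_density q s t x y \<le> (\<kappa> + \<eta>) * (t - s) * qOU_density q y"
    by (rule qOU_transition_density_bounds[OF q_bounds assms]) blast
  \<comment> \<open>\<open>R / 2\<close> gives \<open>d < R\<close>, which keeps the thresholds
    \<open>- R + \<epsilon>\<close> and \<open>R - \<epsilon>\<close> apart.\<close>
  define d where "d = min e (R / 2)"
  have d: "0 < d" "d < R" "d \<le> e" using e R_pos by (auto simp: d_def)
  have h: "(\<kappa> - \<eta>) * (t - s) * edge_mass \<epsilon> \<le> (LINT y:{R - \<epsilon><..}|lborel. qOU_transition_density q s t x y) \<and>
      (LINT y:{R - \<epsilon><..}|lborel. qOU_transition_density q s t x y) \<le> (\<kappa> + \<eta>) * (t - s) * edge_mass \<epsilon>"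
    if st: "0 \<le> s" "s < t" "t < s + d" and \<epsilon>: "0 < \<epsilon>" "\<epsilon> \<le> d"
      and x: "x \<in> qOU_state_space q" "x < - R + \<epsilon>" for s t \<epsilon> x
  proof -
    let ?U = "{R - \<epsilon><..}" and ?T = "qOU_transition_density q s t x"
    have T: "qOU_phi_prod q (t - s) x y \<noteq> 0"
       "(\<kappa> - \<eta>) * (t - s) * qOU_density q y \<le> ?T y" "?T y \<le> (\<kappa> + \<eta>) * (t - s) * qOU_density q y"
      if "y \<in> ?U \<inter> qOU_state_space q" for y
      using bounds[of s t x y] st \<epsilon> x d that by auto
    have T0: "?T y = 0" "qOU_density q y = 0" if "y \<notin> qOU_state_space q" for y
      using that by (auto simp: qOU_transition_density_def qOU_density_def)
    have intp: "set_integrable lborel ?U (\<lambda>y. k * qOU_density q y)" for k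
      unfolding set_integrable_def
      by (intro integrable_mult_indicator integrable_mult_right integrable_density) auto
    define C where "C = (1 - exp (- 2 * (t - s))) * (\<Prod>k. 1 - exp (- 2 * (t - s)) * q ^ Suc k)"
    \<comment> \<open>Measurability of \<open>?T\<close> in \<open>y\<close>: near the upper edge
      the denominator is continuous and nonzero, and elsewhere in \<open>?U\<close> the density
      vanishes.\<close>
    have "continuous_on (?U \<inter> qOU_state_space q)
        ((\<lambda>(\<delta>, x, y). qOU_phi_prod q \<delta> x y) \<circ> (\<lambda>y. (t - s, x, y)))"
      using st d e x
      by (intro continuous_on_compose continuous_intros continuous_on_subset[OF continuous_on_qOU_phi_prod[OF q_bounds]])
        auto
    then have "continuous_on (?U \<inter> qOU_state_space q) (\<lambda>y. C / qOU_phi_prod q (t - s) x y)"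
      using T(1) by (intro continuous_intros) (auto simp: o_def)
    then have "(\<lambda>y. indicator (?U \<inter> qOU_state_space q) y *\<^sub>R (C / qOU_phi_prod q (t - s) x y)) \<in> borel_measurable borel"
      by (intro borel_measurable_continuous_on_indicator) (auto simp: qOU_state_space_def)
    then have "(\<lambda>y. indicator (?U \<inter> qOU_state_space q) y *\<^sub>R (C / qOU_phi_prod q (t - s) x y) * qOU_density q y) \<in> borel_measurable borel"
      by (intro borel_measurable_times measurable_density)
    also have "(\<lambda>y. indicator (?U \<inter> qOU_state_space q) y *\<^sub>R (C / qOU_phi_prod q (t - s) x y) * qOU_density q y)
       = (\<lambda>y. indicator ?U y *\<^sub>R ?T y)"
      using T0 by (auto simp: fun_eq_iff C_def qOU_transition_density_eq[OF q_bounds st(2) x(1)] split: split_indicator)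
    finally have meas: "set_borel_measurable lborel ?U ?T"
      by (simp add: set_borel_measurable_def)
    have intT: "set_integrable lborel ?U ?T"
    proof (rule set_integrable_bound[OF intp[of "(\<kappa> + \<eta>) * (t - s)"] meas], intro AE_I2 impI)
      fix y assume y: "y \<in> ?U"
      show "norm (?T y) \<le> norm ((\<kappa> + \<eta>) * (t - s) * qOU_density q y)"
      proof (cases "y \<in> qOU_state_space q")
        case True
        have "0 \<le> (t - s) * qOU_density q y"
          using st qOU_density_nonneg[OF q_bounds] by simp
        \<comment> \<open>As \<open>\<kappa> - \<eta>\<close> may be negative, the lower bound is
          relaxed to the negative of the upper one to control the norm.\<close>
        then have "(- (\<kappa> + \<eta>)) * ((t - s) * qOU_density q y) \<le> (\<kappa> - \<eta>) * ((t - s) * qOU_density q y)"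
          and "0 \<le> (\<kappa> + \<eta>) * ((t - s) * qOU_density q y)"
          using qOU_jump_rate_pos[OF q_bounds] assms by (auto intro!: mult_right_mono mult_nonneg_nonneg)
        with T(2,3)[of y] y True show ?thesis
          unfolding mult.assoc mult_minus_left by auto
      qed (use T0 in auto)
    qed
    have pw: "(\<kappa> - \<eta>) * (t - s) * qOU_density q y \<le> ?T y \<and> ?T y \<le> (\<kappa> + \<eta>) * (t - s) * qOU_density q y"
      if "y \<in> ?U" for y
      using T[of y] T0[of y] that by (cases "y \<in> qOU_state_space q") auto
    have "(LINT y:?U|lborel. (\<kappa> - \<eta>) * (t - s) * qOU_density q y) \<le> (LINT y:?U|lborel. ?T y)"
      "(LINT y:?U|lborel. ?T y) \<le> (LINT y:?U|lborel. (\<kappa> + \<eta>) * (t - s) * qOU_density q y)"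
      using pw by (intro set_integral_mono intp intT; blast)+
    then show ?thesis
      by (simp add: edge_mass_def)
  qed
  show thesis
  proof (rule that[OF d(1,2)])
    fix s t \<epsilon> E
    assume st: "0 \<le> s" "s < t" "t < s + d" and \<epsilon>: "0 < \<epsilon>" "\<epsilon> \<le> d"
      and E: "E \<in> sets (natural_past M X s)" "E \<subseteq> {\<omega> \<in> space M. X s \<omega> < - R + \<epsilon>}"
    have EM: "E \<in> sets M" using E(1) subalgebra_natural_past[of s] by (auto simp: subalgebra_def)
    obtain g where g: "AE \<omega> in M. g \<omega> = (LINT y:{R - \<epsilon><..}|lborel. qOU_transition_density q s t (X s \<omega>) y)"
      "set_integrable M E g" "prob (E \<inter> {\<omega> \<in> space M. X t \<omega> \<in> {R - \<epsilon><..}}) = (LINT \<omega>:E|M. g \<omega>)"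
      using markov[OF st(1,2) E(1), of "{R - \<epsilon><..}"] by auto
    have AE_g: "AE \<omega>\<in>E in M. (\<kappa> - \<eta>) * (t - s) * edge_mass \<epsilon> \<le> g \<omega>"
      "AE \<omega>\<in>E in M. g \<omega> \<le> (\<kappa> + \<eta>) * (t - s) * edge_mass \<epsilon>"
      using g(1) by (eventually_elim; use E(2) h[OF st \<epsilon>] X_in_state_space[OF st(1)] in fastforce)+
    have const: "set_integrable M E (\<lambda>_. k)" "(LINT \<omega>:E|M. k) = k * prob E" for k :: real
      using EM by (auto simp: set_integrable_def set_integral_const emeasure_eq_measure)
    have "(LINT \<omega>:E|M. (\<kappa> - \<eta>) * (t - s) * edge_mass \<epsilon>) \<le> (LINT \<omega>:E|M. g \<omega>)"
      by (intro set_integral_mono_AE const g(2) AE_g)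
    moreover have "(LINT \<omega>:E|M. g \<omega>) \<le> (LINT \<omega>:E|M. (\<kappa> + \<eta>) * (t - s) * edge_mass \<epsilon>)"
      by (intro set_integral_mono_AE const g(2) AE_g)
    ultimately show "(\<kappa> - \<eta>) * (t - s) * edge_mass \<epsilon> * prob E \<le> prob (E \<inter> {\<omega> \<in> space M. R - \<epsilon> < X t \<omega>}) \<and>
      prob (E \<inter> {\<omega> \<in> space M. R - \<epsilon> < X t \<omega>}) \<le> (\<kappa> + \<eta>) * (t - s) * edge_mass \<epsilon> * prob E"
      using g(3) by (simp add: const mult_ac)
  qed
qed

section \<open>Passages along the grid\<close>

definition hits :: "nat \<Rightarrow> real \<Rightarrow> nat \<Rightarrow> 'a set" where
  "hits n \<epsilon> j = {\<omega> \<in> space M. \<exists>i<j. X (real i / real n) \<omega> < - R + \<epsilon> \<and> R - \<epsilon> < X (real (Suc i) / real n) \<omega>}"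

lemma hits_eq_grid_jump: "hits n \<epsilon> n = {\<omega> \<in> space M. grid_jump (\<lambda>t. X t \<omega>) (- R + \<epsilon>) (R - \<epsilon>) n}"
  by (simp add: hits_def grid_jump_def)

lemma sets_natural_past_imp_sets: "E \<in> sets (natural_past M X s) \<Longrightarrow> E \<in> sets M"
  using subalgebra_natural_past[of s] by (auto simp: subalgebra_def)

lemma hits_Suc: "hits n \<epsilon> (Suc j) = hits n \<epsilon> j \<union>
  ({\<omega> \<in> space M. X (real j / real n) \<omega> < - R + \<epsilon>} \<inter> {\<omega> \<in> space M. R - \<epsilon> < X (real (Suc j) / real n) \<omega>})"
  by (auto simp: hits_def less_Suc_eq)

text \<open>The first \<open>j\<close> steps end exactly when step \<open>j\<close> starts, so an
  earlier passage is an admissible past event for the next step.\<close>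

lemma hits_in_natural_past: "hits n \<epsilon> j \<in> sets (natural_past M X (real j / real n))"
proof (induction j)
  case 0
  show ?case by (simp add: hits_def)
next
  case (Suc j)
  have le: "real j / real n \<le> real (Suc j) / real n"
    by (simp add: divide_right_mono)
  have "{\<omega> \<in> space M. X (real j / real n) \<omega> \<in> {..<- R + \<epsilon>}} \<in> sets (natural_past M X (real (Suc j) / real n))"
    "{\<omega> \<in> space M. X (real (Suc j) / real n) \<omega> \<in> {R - \<epsilon><..}} \<in> sets (natural_past M X (real (Suc j) / real n))"
    using le by (intro vimage_in_natural_past; simp)+
  with Suc natural_past_mono[OF le] show ?case
    unfolding hits_Suc by auto
qed

lemma hits_in_sets: "hits n \<epsilon> j \<in> sets M"
  using hits_in_natural_past by (rule sets_natural_past_imp_sets)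

text \<open>Induction over the steps, adding one possible passage and subtracting its overlap with
  the earlier ones; this replaces an inclusion-exclusion over all pairs of steps.\<close>

lemma hits_bounds:
  assumes "0 < \<eta>"
  obtains d where "0 < d" "d < R"
    "\<And>\<epsilon>. \<lbrakk>0 < \<epsilon>; \<epsilon> \<le> d\<rbrakk> \<Longrightarrow> \<forall>\<^sub>F n in sequentially.
        (\<kappa> - \<eta>) * edge_mass \<epsilon> ^ 2 - (\<kappa> + \<eta>)\<^sup>2 * edge_mass \<epsilon> ^ 3 \<le> prob (hits n \<epsilon> n) \<and>
        prob (hits n \<epsilon> n) \<le> (\<kappa> + \<eta>) * edge_mass \<epsilon> ^ 2"
proof -
  obtain d where d: "0 < d" "d < R" and step:
    "\<And>s t \<epsilon> E. \<lbrakk>0 \<le> s; s < t; t < s + d; 0 < \<epsilon>; \<epsilon> \<le> d; E \<in> sets (natural_past M X s);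
        E \<subseteq> {\<omega> \<in> space M. X s \<omega> < - R + \<epsilon>}\<rbrakk> \<Longrightarrow>
      (\<kappa> - \<eta>) * (t - s) * edge_mass \<epsilon> * prob E \<le> prob (E \<inter> {\<omega> \<in> space M. R - \<epsilon> < X t \<omega>}) \<and>
      prob (E \<inter> {\<omega> \<in> space M. R - \<epsilon> < X t \<omega>}) \<le> (\<kappa> + \<eta>) * (t - s) * edge_mass \<epsilon> * prob E"
    by (rule step_bounds[OF assms]) blast
  show thesis
  proof (rule that[OF d])
    fix \<epsilon> assume \<epsilon>: "0 < \<epsilon>" "\<epsilon> \<le> d"
    define m where "m = edge_mass \<epsilon>"
    have m: "0 \<le> m" unfolding m_def by (rule edge_mass_nonneg)
    have \<kappa>: "0 \<le> \<kappa> + \<eta>" using qOU_jump_rate_pos[OF q_bounds] assms by simp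
    have "\<forall>\<^sub>F n in sequentially. 1 / real n < d"
      using d by real_asymp
    then show "\<forall>\<^sub>F n in sequentially.
        (\<kappa> - \<eta>) * edge_mass \<epsilon> ^ 2 - (\<kappa> + \<eta>)\<^sup>2 * edge_mass \<epsilon> ^ 3 \<le> prob (hits n \<epsilon> n) \<and>
        prob (hits n \<epsilon> n) \<le> (\<kappa> + \<eta>) * edge_mass \<epsilon> ^ 2"
      using eventually_gt_at_top[of 0]
    proof eventually_elim
      case (elim n)
      \<comment> \<open>Upper bound for the probability of one step into the upper edge, given a
        past that ends near the lower edge.\<close>
      define b where "b = (\<kappa> + \<eta>) * (1 / real n) * m"
      have b: "0 \<le> b" using \<kappa> m by (simp add: b_def)
      \<comment> \<open>The overlap at step \<open>j\<close> is at most
        \<open>j * b * b * m\<close>; replacing \<open>j\<close> by \<open>n\<close> makes the loss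
        per step constant, so the induction is linear in \<open>j\<close>.\<close>
      have "real j * ((\<kappa> - \<eta>) * (1 / real n) * m * m - real n * b * b * m) \<le> prob (hits n \<epsilon> j) \<and>
          prob (hits n \<epsilon> j) \<le> real j * (b * m)" if "j \<le> n" for j
        using that
      proof (induction j)
        case 0
        show ?case by (simp add: hits_def)
      next
        case (Suc j)
        let ?s = "real j / real n" and ?t = "real (Suc j) / real n"
        define H L U where "H = hits n \<epsilon> j" and "L = {\<omega> \<in> space M. X ?s \<omega> < - R + \<epsilon>}"
          and "U = {\<omega> \<in> space M. R - \<epsilon> < X ?t \<omega>}"
        have st: "0 \<le> ?s" "?s < ?t" "?t < ?s + d" "?t - ?s = 1 / real n"
          using elim by (auto simp: add_divide_distrib diff_divide_distrib divide_strict_right_mono)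
        have L: "L \<in> sets (natural_past M X ?s)"
          using vimage_in_natural_past[of ?s ?s "{..<- R + \<epsilon>}"] by (simp add: L_def)
        have H: "H \<in> sets (natural_past M X ?s)"
          unfolding H_def by (rule hits_in_natural_past)
        have sets: "H \<in> sets M" "L \<in> sets M" "U \<in> sets M" "H \<inter> (L \<inter> U) \<in> sets M"
          using sets_natural_past_imp_sets[OF L] sets_natural_past_imp_sets[OF H]
          by (auto simp: U_def)
        have probL: "prob L = m"
          unfolding L_def m_def by (rule prob_lower_edge) simp
        have LU: "(\<kappa> - \<eta>) * (1 / real n) * m * m \<le> prob (L \<inter> U)" "prob (L \<inter> U) \<le> b * m"
          using step[OF st(1-3) \<epsilon> L] probL
          unfolding U_def[symmetric] st(4) m_def[symmetric] b_def by (auto simp: L_def)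
        have IH: "real j * ((\<kappa> - \<eta>) * (1 / real n) * m * m - real n * b * b * m) \<le> prob H"
            "prob H \<le> real j * (b * m)"
          using Suc by (auto simp: H_def)
        have "prob (H \<inter> (L \<inter> U)) \<le> b * prob (H \<inter> L)"
          using step[OF st(1-3) \<epsilon>, of "H \<inter> L"] H L
          unfolding U_def[symmetric] st(4) m_def[symmetric] b_def by (auto simp: L_def Int_assoc)
        \<comment> \<open>Here \<open>L\<close> is dropped: the bound on the earlier passage alone
          is small enough.\<close>
        also have "\<dots> \<le> b * (real j * (b * m))"
          using b IH(2) finite_measure_mono[of "H \<inter> L" H] sets by (intro mult_left_mono) auto
        also have "\<dots> \<le> b * (real n * (b * m))"
          using b m Suc.prems by (intro mult_left_mono mult_right_mono) auto
        finally have HLU: "prob (H \<inter> (L \<inter> U)) \<le> real n * b * b * m" by (simp add: mult_ac)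
        have "hits n \<epsilon> (Suc j) = H \<union> (L \<inter> U)"
          by (simp add: hits_Suc H_def L_def U_def)
        then have "prob (hits n \<epsilon> (Suc j)) = prob H + prob (L \<inter> U) - prob (H \<inter> (L \<inter> U))"
          using sets by (simp add: finite_measure_Union' finite_measure_Diff' Int_commute)
        moreover have "0 \<le> prob (H \<inter> (L \<inter> U))"
          by simp
        ultimately show ?case
          using IH LU HLU
          unfolding of_nat_Suc distrib_right mult_1_left by linarith
      qed
      from this[of n] have "real n * ((\<kappa> - \<eta>) * (1 / real n) * m * m - real n * b * b * m) \<le> prob (hits n \<epsilon> n)"
          "prob (hits n \<epsilon> n) \<le> real n * (b * m)"
        by auto
      moreover have "real n * ((\<kappa> - \<eta>) * (1 / real n) * m * m - real n * b * b * m)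
          = (\<kappa> - \<eta>) * m ^ 2 - (\<kappa> + \<eta>)\<^sup>2 * m ^ 3"
        using elim by (simp add: b_def right_diff_distrib power2_eq_square power3_eq_cube)
      moreover have "real n * (b * m) = (\<kappa> + \<eta>) * m ^ 2"
        using elim by (simp add: b_def power2_eq_square)
      ultimately show ?case
        by (simp add: m_def)
    qed
  qed
qed

section \<open>From grid passages to the jump event\<close>

lemma jump_event_iff:
  assumes "\<omega> \<in> space M"
  shows "\<omega> \<in> qOU_jump_event q M X \<epsilon> \<longleftrightarrow>
    (\<exists>t\<in>{0<..1}. left_limit (\<lambda>s. X s \<omega>) t < - R + \<epsilon> \<and> R - \<epsilon> < X t \<omega>)"
  using assms by (simp add: qOU_jump_event_def qOU_radius_def)

lemma jump_event_imp_hits: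
  assumes "\<omega> \<in> qOU_jump_event q M X \<epsilon>" "cadlag (\<lambda>t. X t \<omega>)"
  shows "\<forall>\<^sub>F n in sequentially. \<omega> \<in> hits n \<epsilon> n"
proof -
  have \<omega>: "\<omega> \<in> space M" using assms(1) by (simp add: qOU_jump_event_def)
  then obtain t where "t \<in> {0<..1}" "left_limit (\<lambda>s. X s \<omega>) t < - R + \<epsilon>" "R - \<epsilon> < X t \<omega>"
    using assms(1) by (auto simp: jump_event_iff)
  then have "\<forall>\<^sub>F n in sequentially. grid_jump (\<lambda>t. X t \<omega>) (- R + \<epsilon>) (R - \<epsilon>) n"
    using assms(2) by (intro cadlag_jump_imp_grid_jump[where t = t]) auto
  then show ?thesis
    using \<omega> by (simp add: hits_eq_grid_jump)
qed

text \<open>\<open>\<epsilon>' < R\<close> orders the two thresholds, and enlarging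
  \<open>\<epsilon>'\<close> to \<epsilon> makes the weak inequalities of the limit strict
  again.\<close>

lemma frequently_hits_imp_jump_event:
  assumes "\<exists>\<^sub>F n in sequentially. \<omega> \<in> hits n \<epsilon>' n" "cadlag (\<lambda>t. X t \<omega>)" "\<epsilon>' < \<epsilon>" "\<epsilon>' < R"
  shows "\<omega> \<in> qOU_jump_event q M X \<epsilon>"
proof -
  have \<omega>: "\<omega> \<in> space M"
    using assms(1) by (auto simp: hits_def dest: frequently_ex)
  have "\<exists>\<^sub>F n in sequentially. grid_jump (\<lambda>t. X t \<omega>) (- R + \<epsilon>') (R - \<epsilon>') n"
    using assms(1) by (rule frequently_elim1) (simp add: hits_eq_grid_jump)
  then have "\<exists>t\<in>{0<..1}. left_limit (\<lambda>t. X t \<omega>) t \<le> - R + \<epsilon>' \<and> R - \<epsilon>' \<le> X t \<omega>"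
    using assms by (intro frequently_grid_jump_imp_jump) auto
  then show ?thesis
    using \<omega> assms(3) by (force simp: jump_event_iff)
qed

text \<open>The strict inequalities at the jump time leave room for a slightly smaller width; a
  countable family of widths is used with a view to measurability.\<close>

lemma jump_event_approx:
  assumes "\<omega> \<in> qOU_jump_event q M X \<epsilon>" "cadlag (\<lambda>t. X t \<omega>)" "0 < \<epsilon>"
  shows "\<exists>m. \<forall>\<^sub>F n in sequentially. \<omega> \<in> hits n (\<epsilon> * (1 - 1 / real (Suc m))) n"
proof -
  have \<omega>: "\<omega> \<in> space M" using assms(1) by (simp add: qOU_jump_event_def)
  then obtain t where t: "t \<in> {0<..1}" "left_limit (\<lambda>s. X s \<omega>) t < - R + \<epsilon>" "R - \<epsilon> < X t \<omega>"
    using assms(1) by (auto simp: jump_event_iff)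
  have "(\<lambda>m. \<epsilon> * (1 - 1 / real (Suc m))) \<longlonglongrightarrow> \<epsilon>"
    by real_asymp
  moreover have "max (left_limit (\<lambda>s. X s \<omega>) t + R) (R - X t \<omega>) < \<epsilon>"
    using t by auto
  ultimately have "\<forall>\<^sub>F m in sequentially. max (left_limit (\<lambda>s. X s \<omega>) t + R) (R - X t \<omega>) < \<epsilon> * (1 - 1 / real (Suc m))"
    by (rule order_tendstoD)
  then obtain m where m: "max (left_limit (\<lambda>s. X s \<omega>) t + R) (R - X t \<omega>) < \<epsilon> * (1 - 1 / real (Suc m))"
    by (auto simp: eventually_sequentially)
  define \<epsilon>' where "\<epsilon>' = \<epsilon> * (1 - 1 / real (Suc m))"
  have "\<omega> \<in> qOU_jump_event q M X \<epsilon>'"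
    using m t(1) \<omega> unfolding \<epsilon>'_def[symmetric] by (auto simp: jump_event_iff intro!: bexI[of _ t])
  then show ?thesis
    unfolding \<epsilon>'_def using assms(2) jump_event_imp_hits by blast
qed

text \<open>On cadlag paths the event coincides with \<open>D\<close>, a countable combination of
  grid events with widths below \<epsilon>. This matters because \<open>measure\<close> is 0 on sets
  outside the sigma-algebra, so a lower bound needs measurability.\<close>

lemma jump_event_in_completion:
  assumes cadlag: "AE \<omega> in M. cadlag (\<lambda>t. X t \<omega>)" and \<epsilon>: "0 < \<epsilon>" "\<epsilon> < R"
  shows "qOU_jump_event q M X \<epsilon> \<in> sets (completion M)"
proof -
    define D where "D = (\<Union>m. \<Inter>N. \<Union>n\<in>{N..}. hits n (\<epsilon> * (1 - 1 / real (Suc m))) n)"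
  have D: "D \<in> sets M"
    unfolding D_def by (intro sets.countable_UN' sets.countable_INT' image_subsetI hits_in_sets) auto
  have "AE \<omega> in completion M. \<omega> \<in> D \<longleftrightarrow> \<omega> \<in> qOU_jump_event q M X \<epsilon>"
  proof (rule AE_completion, use cadlag in eventually_elim)
    fix \<omega> assume c: "cadlag (\<lambda>t. X t \<omega>)"
    have "\<omega> \<in> qOU_jump_event q M X \<epsilon>" if "\<omega> \<in> D"
    proof -
      obtain m where "\<exists>\<^sub>F n in sequentially. \<omega> \<in> hits n (\<epsilon> * (1 - 1 / real (Suc m))) n"
        using \<open>\<omega> \<in> D\<close> unfolding D_def UN_iff limsup_iff_frequently by blast
      moreover have lt: "\<epsilon> * (1 - 1 / real (Suc m)) < \<epsilon>"
        using \<epsilon> by (simp add: right_diff_distrib)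
      ultimately show ?thesis
        by (intro frequently_hits_imp_jump_event[OF _ c]) (assumption, rule lt, use lt \<epsilon>(2) in linarith)
    qed
    moreover have "\<omega> \<in> D" if "\<omega> \<in> qOU_jump_event q M X \<epsilon>"
      using jump_event_approx[OF that c \<epsilon>(1)] eventually_frequently[OF sequentially_bot]
      unfolding D_def UN_iff limsup_iff_frequently by blast
    ultimately show "\<omega> \<in> D \<longleftrightarrow> \<omega> \<in> qOU_jump_event q M X \<epsilon>" by blast
  qed
  then show ?thesis
    by (rule completion.in_sets_AE) (use D in \<open>auto simp: qOU_jump_event_def\<close>)
qed

text \<open>The upper bound uses the limes inferior of the grid events at \<epsilon> itself, the
  lower bound the limes superior at a smaller \<open>\<epsilon>'\<close>.\<close>

lemma jump_prob_bounds:
  assumes cadlag: "AE \<omega> in M. cadlag (\<lambda>t. X t \<omega>)" and "0 < \<eta>"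
  obtains d where "0 < d"
    "\<And>\<epsilon>. \<lbrakk>0 < \<epsilon>; \<epsilon> \<le> d\<rbrakk> \<Longrightarrow> qOU_jump_prob q M X \<epsilon> \<le> (\<kappa> + \<eta>) * edge_mass \<epsilon> ^ 2"
    "\<And>\<epsilon> \<epsilon>'. \<lbrakk>0 < \<epsilon>'; \<epsilon>' < \<epsilon>; \<epsilon> \<le> d\<rbrakk> \<Longrightarrow>
       (\<kappa> - \<eta>) * edge_mass \<epsilon>' ^ 2 - (\<kappa> + \<eta>)\<^sup>2 * edge_mass \<epsilon>' ^ 3 \<le> qOU_jump_prob q M X \<epsilon>"
proof -
  interpret C: prob_space "completion M" by (rule prob_space_completion)
  obtain d where d: "0 < d" "d < R" and hits:
    "\<And>\<epsilon>. \<lbrakk>0 < \<epsilon>; \<epsilon> \<le> d\<rbrakk> \<Longrightarrow> \<forall>\<^sub>F n in sequentially.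
        (\<kappa> - \<eta>) * edge_mass \<epsilon> ^ 2 - (\<kappa> + \<eta>)\<^sup>2 * edge_mass \<epsilon> ^ 3 \<le> prob (hits n \<epsilon> n) \<and>
        prob (hits n \<epsilon> n) \<le> (\<kappa> + \<eta>) * edge_mass \<epsilon> ^ 2"
    by (rule hits_bounds[OF \<open>0 < \<eta>\<close>]) blast
  show thesis
  proof (rule that[OF d(1)])
    fix \<epsilon> assume \<epsilon>: "0 < \<epsilon>" "\<epsilon> \<le> d"
    let ?I = "\<Union>N. \<Inter>n\<in>{N..}. hits n \<epsilon> n"
    have I: "?I \<in> sets M"
      by (intro sets.countable_UN' sets.countable_INT' image_subsetI hits_in_sets) auto
    have "qOU_jump_prob q M X \<epsilon> \<le> measure (completion M) ?I"
      unfolding qOU_jump_prob_def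
    proof (rule C.finite_measure_mono_AE)
      show "AE \<omega> in completion M. \<omega> \<in> qOU_jump_event q M X \<epsilon> \<longrightarrow> \<omega> \<in> ?I"
        unfolding liminf_iff_eventually
        by (rule AE_completion, use cadlag in eventually_elim) (blast intro: jump_event_imp_hits)
    qed (use I in auto)
    also have "\<dots> = prob ?I" using I by simp
    also have "\<dots> \<le> (\<kappa> + \<eta>) * edge_mass \<epsilon> ^ 2"
      by (rule measure_liminf_le) (use hits[OF \<epsilon>] in \<open>auto intro: hits_in_sets elim: eventually_mono\<close>)
    finally show "qOU_jump_prob q M X \<epsilon> \<le> (\<kappa> + \<eta>) * edge_mass \<epsilon> ^ 2" .
  next
    fix \<epsilon> \<epsilon>' assume \<epsilon>: "0 < \<epsilon>'" "\<epsilon>' < \<epsilon>" "\<epsilon> \<le> d"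
    let ?S = "\<Inter>N. \<Union>n\<in>{N..}. hits n \<epsilon>' n"
    have S: "?S \<in> sets M"
      by (intro sets.countable_UN' sets.countable_INT' image_subsetI hits_in_sets) auto
    have "(\<kappa> - \<eta>) * edge_mass \<epsilon>' ^ 2 - (\<kappa> + \<eta>)\<^sup>2 * edge_mass \<epsilon>' ^ 3 \<le> prob ?S"
      by (rule measure_limsup_ge) (use hits[of \<epsilon>'] \<epsilon> in \<open>auto intro: hits_in_sets elim: eventually_mono\<close>)
    also have "\<dots> = measure (completion M) ?S" using S by simp
    also have "\<dots> \<le> qOU_jump_prob q M X \<epsilon>"
      unfolding qOU_jump_prob_def
    proof (rule C.finite_measure_mono_AE)
      have "\<epsilon>' < R" using \<epsilon> d by simp
      then show "AE \<omega> in completion M. \<omega> \<in> ?S \<longrightarrow> \<omega> \<in> qOU_jump_event q M X \<epsilon>"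
        unfolding limsup_iff_frequently using \<epsilon>(2)
        by (intro AE_completion, use cadlag in eventually_elim) (blast intro: frequently_hits_imp_jump_event)
      show "qOU_jump_event q M X \<epsilon> \<in> sets (completion M)"
        using \<epsilon> d by (intro jump_event_in_completion cadlag) auto
    qed
    finally show "(\<kappa> - \<eta>) * edge_mass \<epsilon>' ^ 2 - (\<kappa> + \<eta>)\<^sup>2 * edge_mass \<epsilon>' ^ 3 \<le> qOU_jump_prob q M X \<epsilon>" .
  qed
qed

text \<open>The cube arises because the edge mass is of order \<epsilon> to the power 3/2 and enters
  squared; \<open>g\<close> is the edge mass in this scaling.\<close>

lemma jump_prob_tendsto:
  assumes cadlag: "AE \<omega> in M. cadlag (\<lambda>t. X t \<omega>)"
  shows "((\<lambda>\<epsilon>. qOU_jump_prob q M X \<epsilon> / \<epsilon> ^ 3) \<longlongrightarrow> qOU_alpha q) (at_right 0)"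
proof -
  define w where "w = 2 / 3 * qOU_edge q R"
  have alpha: "qOU_alpha q = \<kappa> * w\<^sup>2"
    unfolding w_def by (rule qOU_alpha_eq[OF q_bounds])
  define g where "g = (\<lambda>\<epsilon>. edge_mass \<epsilon> / (\<epsilon> * sqrt \<epsilon>))"
  have g: "(g \<longlongrightarrow> w) (at_right 0)"
    unfolding g_def w_def by (rule edge_mass_tendsto)
  have mass: "edge_mass \<epsilon> = g \<epsilon> * (\<epsilon> * sqrt \<epsilon>)" if "0 < \<epsilon>" for \<epsilon>
    using that by (simp add: g_def)
  have cube: "(\<epsilon> * sqrt \<epsilon>)\<^sup>2 = \<epsilon> ^ 3" if "0 < \<epsilon>" for \<epsilon> :: real
    using that by (simp add: power_mult_distrib power3_eq_cube power2_eq_square)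
  show ?thesis
  proof (rule order_tendstoI)
    fix a assume a: "qOU_alpha q < a"
    have "((\<lambda>\<eta>. (\<kappa> + \<eta>) * w\<^sup>2) \<longlongrightarrow> (\<kappa> + 0) * w\<^sup>2) (at_right 0)"
      by (intro tendsto_intros)
    then have "\<forall>\<^sub>F \<eta> in at_right 0. (\<kappa> + \<eta>) * w\<^sup>2 < a"
      by (rule order_tendstoD) (use a alpha in simp)
    moreover have "\<forall>\<^sub>F \<eta> in at_right 0. 0 < (\<eta>::real)"
      by (auto simp: eventually_at_filter)
    ultimately have "\<forall>\<^sub>F \<eta> in at_right 0. 0 < \<eta> \<and> (\<kappa> + \<eta>) * w\<^sup>2 < a"
      by eventually_elim auto
    then obtain \<eta> where \<eta>: "0 < \<eta>" "(\<kappa> + \<eta>) * w\<^sup>2 < a"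
      by (auto dest: eventually_happens'[rotated])
    obtain d where d: "0 < d"
      and upper: "\<And>\<epsilon>. \<lbrakk>0 < \<epsilon>; \<epsilon> \<le> d\<rbrakk> \<Longrightarrow> qOU_jump_prob q M X \<epsilon> \<le> (\<kappa> + \<eta>) * edge_mass \<epsilon> ^ 2"
      by (rule jump_prob_bounds[OF cadlag \<eta>(1)]) blast
    have "((\<lambda>\<epsilon>. (\<kappa> + \<eta>) * (g \<epsilon>)\<^sup>2) \<longlongrightarrow> (\<kappa> + \<eta>) * w\<^sup>2) (at_right 0)"
      by (intro tendsto_intros g)
    then have "\<forall>\<^sub>F \<epsilon> in at_right 0. (\<kappa> + \<eta>) * (g \<epsilon>)\<^sup>2 < a"
      using \<eta>(2) by (rule order_tendstoD)
    moreover have "\<forall>\<^sub>F \<epsilon> in at_right 0. 0 < \<epsilon> \<and> \<epsilon> \<le> d"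
      using d by (intro eventually_at_rightI[of 0 d]) auto
    ultimately show "\<forall>\<^sub>F \<epsilon> in at_right 0. qOU_jump_prob q M X \<epsilon> / \<epsilon> ^ 3 < a"
    proof eventually_elim
      case (elim \<epsilon>)
      have "qOU_jump_prob q M X \<epsilon> \<le> (\<kappa> + \<eta>) * edge_mass \<epsilon> ^ 2"
        using upper elim by simp
      also have "\<dots> = (\<kappa> + \<eta>) * (g \<epsilon>)\<^sup>2 * \<epsilon> ^ 3"
        using elim mass[of \<epsilon>] cube[of \<epsilon>] by (simp only: power_mult_distrib[of "g \<epsilon>"] mult.assoc)
      also have "\<dots> < a * \<epsilon> ^ 3"
        using elim by (intro mult_strict_right_mono) auto
      finally show ?case
        using elim by (simp add: divide_less_eq)
    qed
  next
    fix a assume a: "a < qOU_alpha q"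
    \<comment> \<open>One \<eta> has two roles: the error in the rate, and the shrinking of the
      width to \<open>(1 - \<eta>) * \<epsilon>\<close>, which costs the cubed factor.\<close>
    have "((\<lambda>\<eta>. (1 - \<eta>) ^ 3 * ((\<kappa> - \<eta>) * w\<^sup>2)) \<longlongrightarrow> (1 - 0) ^ 3 * ((\<kappa> - 0) * w\<^sup>2)) (at_right 0)"
      by (intro tendsto_intros)
    then have "\<forall>\<^sub>F \<eta> in at_right 0. a < (1 - \<eta>) ^ 3 * ((\<kappa> - \<eta>) * w\<^sup>2)"
      by (rule order_tendstoD) (use a alpha in simp)
    moreover have "\<forall>\<^sub>F \<eta> in at_right 0. 0 < (\<eta>::real) \<and> \<eta> < 1"
      by (intro eventually_at_rightI[of 0 1]) auto
    ultimately have "\<forall>\<^sub>F \<eta> in at_right 0. 0 < \<eta> \<and> \<eta> < 1 \<and> a < (1 - \<eta>) ^ 3 * ((\<kappa> - \<eta>) * w\<^sup>2)"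
      by eventually_elim auto
    then obtain \<eta> where \<eta>: "0 < \<eta>" "\<eta> < 1" "a < (1 - \<eta>) ^ 3 * ((\<kappa> - \<eta>) * w\<^sup>2)"
      by (auto dest: eventually_happens'[rotated])
    obtain d where d: "0 < d"
      and lower: "\<And>\<epsilon> \<epsilon>'. \<lbrakk>0 < \<epsilon>'; \<epsilon>' < \<epsilon>; \<epsilon> \<le> d\<rbrakk> \<Longrightarrow>
       (\<kappa> - \<eta>) * edge_mass \<epsilon>' ^ 2 - (\<kappa> + \<eta>)\<^sup>2 * edge_mass \<epsilon>' ^ 3 \<le> qOU_jump_prob q M X \<epsilon>"
      by (rule jump_prob_bounds[OF cadlag \<eta>(1)]) blast
    define \<theta> where "\<theta> = 1 - \<eta>"
    have \<theta>: "0 < \<theta>" "\<theta> < 1" using \<eta> by (auto simp: \<theta>_def)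
    have "filterlim (\<lambda>\<epsilon>. \<theta> * \<epsilon>) (at_right 0) (at_right 0)"
      using \<theta> by real_asymp
    then have g\<theta>: "((\<lambda>\<epsilon>. g (\<theta> * \<epsilon>)) \<longlongrightarrow> w) (at_right 0)"
      by (rule filterlim_compose[OF g])
    \<comment> \<open>The term for repeated passages is cubic in the edge mass, so after division by
      \<open>\<epsilon> ^ 3\<close> it keeps this vanishing factor.\<close>
    have z0: "((\<lambda>\<epsilon>. (\<theta> * \<epsilon>) * sqrt (\<theta> * \<epsilon>)) \<longlongrightarrow> (\<theta> * 0) * sqrt (\<theta> * 0)) (at_right 0)"
      by (intro tendsto_intros)
    have "((\<lambda>\<epsilon>. \<theta> ^ 3 * ((\<kappa> - \<eta>) * (g (\<theta> * \<epsilon>))\<^sup>2 - (\<kappa> + \<eta>)\<^sup>2 * g (\<theta> * \<epsilon>) ^ 3 * ((\<theta> * \<epsilon>) * sqrt (\<theta> * \<epsilon>))))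
        \<longlongrightarrow> \<theta> ^ 3 * ((\<kappa> - \<eta>) * w\<^sup>2 - (\<kappa> + \<eta>)\<^sup>2 * w ^ 3 * ((\<theta> * 0) * sqrt (\<theta> * 0)))) (at_right 0)"
      by (intro z0 tendsto_mult[OF _ z0] tendsto_mult[OF tendsto_const] tendsto_diff tendsto_power g\<theta>)
    then have "\<forall>\<^sub>F \<epsilon> in at_right 0. a < \<theta> ^ 3 * ((\<kappa> - \<eta>) * (g (\<theta> * \<epsilon>))\<^sup>2 - (\<kappa> + \<eta>)\<^sup>2 * g (\<theta> * \<epsilon>) ^ 3 * ((\<theta> * \<epsilon>) * sqrt (\<theta> * \<epsilon>)))"
      by (rule order_tendstoD) (use \<eta>(3) in \<open>simp add: \<theta>_def\<close>)
    moreover have "\<forall>\<^sub>F \<epsilon> in at_right 0. 0 < \<epsilon> \<and> \<epsilon> \<le> d"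
      using d by (intro eventually_at_rightI[of 0 d]) auto
    ultimately show "\<forall>\<^sub>F \<epsilon> in at_right 0. a < qOU_jump_prob q M X \<epsilon> / \<epsilon> ^ 3"
    proof eventually_elim
      case (elim \<epsilon>)
      define \<epsilon>' where "\<epsilon>' = \<theta> * \<epsilon>"
      have \<epsilon>': "0 < \<epsilon>'" "\<epsilon>' < \<epsilon>" using elim \<theta> by (auto simp: \<epsilon>'_def)
      have e3: "\<epsilon>' ^ 3 = \<theta> ^ 3 * \<epsilon> ^ 3" by (simp add: \<epsilon>'_def power_mult_distrib)
      define z where "z = \<epsilon>' * sqrt \<epsilon>'"
      have z2: "z\<^sup>2 = \<epsilon>' ^ 3" unfolding z_def using \<epsilon>'(1) by (rule cube)
      then have z3: "z ^ 3 = \<epsilon>' ^ 3 * z" by (simp add: power3_eq_cube power2_eq_square)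
      have "a * \<epsilon> ^ 3 < \<theta> ^ 3 * ((\<kappa> - \<eta>) * (g \<epsilon>')\<^sup>2 - (\<kappa> + \<eta>)\<^sup>2 * g \<epsilon>' ^ 3 * z) * \<epsilon> ^ 3"
        using elim unfolding \<epsilon>'_def[symmetric] z_def by (intro mult_strict_right_mono) auto
      also have "\<dots> = (\<kappa> - \<eta>) * ((g \<epsilon>')\<^sup>2 * z\<^sup>2) - (\<kappa> + \<eta>)\<^sup>2 * (g \<epsilon>' ^ 3 * z ^ 3)"
        unfolding z2 z3 e3 by (simp add: right_diff_distrib left_diff_distrib mult_ac)
      also have "\<dots> = (\<kappa> - \<eta>) * edge_mass \<epsilon>' ^ 2 - (\<kappa> + \<eta>)\<^sup>2 * edge_mass \<epsilon>' ^ 3"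
        using mass[OF \<epsilon>'(1)] by (simp add: z_def[symmetric] power_mult_distrib)
      also have "\<dots> \<le> qOU_jump_prob q M X \<epsilon>"
        using lower[OF \<epsilon>'] elim by simp
      finally show ?case
        using elim by (simp add: less_divide_eq)
    qed
  qed
qed

end

theorem proposition2p1:
  fixes q :: real and M :: "'a measure" and X :: "real \<Rightarrow> 'a \<Rightarrow> real"
  assumes "-1 < q" and "q < 1"
    and "prob_space M"
    and "qOU_process q M X"
    and "AE \<omega> in M. cadlag (\<lambda>t. X t \<omega>)"
  shows "((\<lambda>\<epsilon>. qOU_jump_prob q M X \<epsilon> / \<epsilon> ^ 3) \<longlongrightarrow> qOU_alpha q) (at_right 0)"
proof -
  interpret prob_space M by fact
  interpret qOU M q X
    by unfold_locales (use assms in auto)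
  show ?thesis using assms(5) by (rule jump_prob_tendsto)
qed
end
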